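(* Let $\mathbb F_q$ be a finite field with $q$ elements, let $n\ge 2$, let $a_1,\dots,a_n,b\in\mathbb F_q^*$ and let $k,k_1,\dots,k_n,m_1,\dots,m_n$ be positive integers. Let $N_q$ be the number of solutions $(x_1,\dots,x_n)\in\mathbb F_q^n$ of $$(a_1x_1^{m_1}+\dots+a_nx_n^{m_n})^k=bx_1^{k_1}\cdots x_n^{k_n}.$$ Let $d_j=\gcd(m_j,q-1)$, $M=\mathrm{lcm}[m_1,\dots,m_n]$ and $k_0=\gcd(k,k_1,\dots,k_n,q-1)$. Assume that for some $0\le t\le n$, $d_1,\dots,d_t$ are odd, $d_{t+1},\dots,d_n$ are even, and $d_1,\dots,d_t,d_{t+1}/2,\dots,d_n/2$ are pairwise coprime; that $b$ is a $k_0$th power in $\mathbb F_q$; and that $$\gcd\Bigl(\sum_{j=1}^n\frac{k_jM}{k_0m_j}-\frac{kM}{k_0},\ \frac{k_1(q-1)}{k_0d_1},\dots,\frac{k_n(q-1)}{k_0d_n},\ \frac{q-1}{k_0}\Bigr)=1.$$ Then: if $t=0$ and $n$ is even, $$N_q=q^{n-1}-1+\frac{(k_0-1)((q-1)^n-1)}{q}-k_0\eta((-1)^{n/2}a_1\cdots a_n)q^{(n-2)/2}-(k_0+q-1)\sum_{j=1}^{(n-2)/2}\eta((-1)^j)\sigma_{2j}(\eta(a_1),\dots,\eta(a_n))q^{j-1};$$ if $t=n$, $$N_q=q^{n-1}-(-1)^n+\frac{(k_0-1)((q-1)^n-(-1)^n)}{q};$$ otherwise $$N_q=q^{n-1}-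(-1)^n+\frac{(k_0-1)((q-1)^n-(-1)^n)}{q}-(-1)^n(k_0+q-1)\sum_{j=1}^{[(n-t)/2]}\eta((-1)^j)\sigma_{2j}(\eta(a_{t+1}),\dots,\eta(a_n))q^{j-1}.$$
   Context: For $q$ odd, $\eta$ is the quadratic character of $\mathbb F_q$: $\eta(x)=1,-1,0$ according as $x$ is a nonzero square, a nonsquare, or $0$ (in the cases where $\eta$ appears, some $d_j$ is even, so $q$ is odd). $\sigma_{2j}(z_1,\dots,z_r)$ denotes the elementary symmetric polynomial of degree $2j$ in $z_1,\dots,z_r$. $[x]$ denotes the integer part; empty sums are $0$. *)

theory Defs
  imports Complex_Main "HOL-Library.FuncSet"
begin

text \<open>Quadratic character of a finite field (meaningful for odd q).\<close>
definition eta :: "'a::{field,finite} \<Rightarrow> real" where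
  "eta x = (if x = 0 then 0 else if (\<exists>y. y ^ 2 = x) then 1 else -1)"

definition esym :: "nat set \<Rightarrow> (nat \<Rightarrow> real) \<Rightarrow> nat \<Rightarrow> real" where
  "esym S z r = (\<Sum>T \<in> {T. T \<subseteq> S \<and> card T = r}. \<Prod>i\<in>T. z i)"

definition Nsol :: "nat \<Rightarrow> (nat \<Rightarrow> 'a::{field,finite}) \<Rightarrow> 'a \<Rightarrow> nat \<Rightarrow> (nat \<Rightarrow> nat) \<Rightarrow> (nat \<Rightarrow> nat) \<Rightarrow> nat" where
  "Nsol n a b k kk m = card {x \<in> PiE {1..n} (\<lambda>_. UNIV).
      (\<Sum>j=1..n. a j * x j ^ m j) ^ k = b * (\<Prod>j=1..n. x j ^ kk j)}"

end

theory Submission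
  imports Defs "HOL-Computational_Algebra.Polynomial"
begin

text \<open>
  If all \<open>x j\<close> are nonzero and the left-hand sum \<open>f x\<close> does not vanish, the torus action
  \<open>x j \<mapsto> \<zeta> j * s powi (M / m j) * x j\<close> with \<open>\<zeta> j ^ m j = 1\<close> multiplies the quotient of the two
  sides by an arbitrary \<open>k0\<close>-th power, thanks to the gcd condition. Hence exactly a fraction
  \<open>k0 / (q - 1)\<close> of these points are solutions, and it remains to count the zeros of \<open>f\<close> with and
  without the restriction \<open>x j \<noteq> 0\<close>.

  The number of zeros of \<open>f\<close> on the torus depends only on the set of vectors \<open>(s * x j ^ m j)\<^sub>j\<close>,
  which by the coprimality assumption does not change if each \<open>m j\<close> is replaced by \<open>1\<close> or \<open>2\<close>
  according to the parity of \<open>gcd (m j) (q - 1)\<close>. For these exponents the count is an iterated additive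
  convolution of functions in the span of \<open>1\<close>, \<open>\<delta>\<^sub>0\<close> and \<open>\<eta>\<close>.
\<close>

section \<open>Equidistribution and roots of unity\<close>

text \<open>Comparing nonempty fibres in one direction suffices, since swapping \<open>y\<close> and
  \<open>y'\<close> gives equality. Both sides are then the common fibre size times the two counts
  of image points; the product form avoids division.\<close>

lemma card_fibers:
  fixes h :: "'x \<Rightarrow> 'y"
  assumes fin: "finite P"
    and eq: "\<And>y y'. y \<in> h ` P \<Longrightarrow> y' \<in> h ` P \<Longrightarrow>
      card {p\<in>P. h p = y} \<le> card {p\<in>P. h p = y'}"
    and y: "y \<in> h ` P"
  shows "card {p\<in>P. h p \<in> Y} * card (h ` P) = card P * card (Y \<inter> h ` P)"
proof -
  define c where "c = card {p\<in>P. h p = y}"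
  have c: "card {p\<in>P. h p = z} = c" if "z \<in> h ` P" for z
    unfolding c_def using eq that y by (meson le_antisym)
  have count: "card {p\<in>P. h p \<in> Z} = c * card (Z \<inter> h ` P)" for Z
  proof -
    have "{p\<in>P. h p \<in> Z} = (\<Union>z\<in>Z \<inter> h ` P. {p\<in>P. h p = z})" by auto
    also have "card \<dots> = (\<Sum>z\<in>Z \<inter> h ` P. card {p\<in>P. h p = z})"
      by (rule card_UN_disjoint) (use fin in auto)
    also have "\<dots> = c * card (Z \<inter> h ` P)"
      by (simp add: c)
    finally show ?thesis .
  qed
  from count[of UNIV] count[of Y] show ?thesis
    by simp
qed

text \<open>\<open>\<psi>\<close> injects the fibre over \<open>h p\<close> into the fibre over
  \<open>h p'\<close>. This captures a group acting transitively on the image of \<open>h\<close>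
  without introducing the group itself.\<close>

lemma card_fibers_action:
  fixes h :: "'x \<Rightarrow> 'y"
  assumes fin: "finite P"
    and act: "\<And>p p'. p \<in> P \<Longrightarrow> p' \<in> P \<Longrightarrow> \<exists>\<psi>. inj_on \<psi> P \<and> (\<forall>r\<in>P. \<psi> r \<in> P \<and> (h r = h p \<longrightarrow> h (\<psi> r) = h p'))"
  shows "card {p\<in>P. h p \<in> Y} * card (h ` P) = card P * card (Y \<inter> h ` P)"
proof (cases "P = {}")
  case False
  then obtain y where y: "y \<in> h ` P" by blast
  show ?thesis
  proof (rule card_fibers[OF fin _ y])
    fix z z' assume "z \<in> h ` P" "z' \<in> h ` P"
    then obtain p p' where p: "p \<in> P" "z = h p" "p' \<in> P" "z' = h p'" by blast
    obtain \<psi> where "inj_on \<psi> P" "\<forall>r\<in>P. \<psi> r \<in> P \<and> (h r = h p \<longrightarrow> h (\<psi> r) = h p')"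
      using act p by blast
    then show "card {p\<in>P. h p = z} \<le> card {p\<in>P. h p = z'}"
      using p by (intro card_inj_on_le[of \<psi>]) (auto simp: fin inj_on_def)
  qed
qed auto

lemma card_field_gt_1: "card (UNIV :: 'a::{field,finite} set) > 1"
proof -
  have "card {0 :: 'a, 1} \<le> card (UNIV :: 'a set)" by (rule card_mono) auto
  then show ?thesis by simp
qed

lemma power_card_minus_1:
  fixes x :: "'a::{field,finite}"
  assumes "x \<noteq> 0"
  shows "x ^ (card (UNIV :: 'a set) - 1) = 1"
proof -
  have bij: "bij_betw ((*) x) (UNIV - {0}) (UNIV - {0})"
    using assms by (intro bij_betwI[where g = "\<lambda>y. y / x"]) auto
  have "(\<Prod>y\<in>UNIV-{0}. y) = (\<Prod>y\<in>UNIV-{0}. x * y)"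
    using prod.reindex_bij_betw[OF bij, of "\<lambda>y. y"] by simp
  also have "\<dots> = x ^ (card (UNIV :: 'a set) - 1) * (\<Prod>y\<in>UNIV-{0}. y)"
    by (simp add: prod.distrib)
  finally show ?thesis by simp
qed

lemma powi_card_minus_1:
  fixes x :: "'a::{field,finite}"
  assumes "x \<noteq> 0"
  shows "x powi (int (card (UNIV :: 'a set) - 1) * i) = 1"
  using power_card_minus_1[OF assms] by (simp add: power_int_mult)

text \<open>With \<open>q - 1 = e * c\<close>, the factorisation
  \<open>x ^ (q - 1) - 1 = (x ^ e - 1) * poly G x\<close> makes every nonzero element a root of one
  factor. At most \<open>e * (c - 1)\<close> of them are roots of \<open>G\<close>, so at least
  \<open>e\<close> remain for the first factor, whose degree allows no more.\<close>

lemma card_roots_of_unity: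
  fixes e :: nat
  assumes "e dvd card (UNIV :: 'a::{field,finite} set) - 1"
  shows "card {x :: 'a. x ^ e = 1} = e"
proof -
  define q where "q = card (UNIV :: 'a set)"
  have q: "q > 1" using card_field_gt_1 by (simp add: q_def)
  from assms obtain c where c: "q - 1 = e * c" by (auto simp: q_def dvd_def)
  with q have e: "e > 0" and c0: "c > 0" by (auto intro!: Nat.gr0I)
  define G :: "'a poly" where "G = (\<Sum>i<c. monom 1 (e * i))"
  define H :: "'a poly" where "H = monom 1 e - 1"
  have degG: "degree G \<le> e * (c - 1)"
    unfolding G_def using c0
    by (intro degree_sum_le) (auto intro!: order.trans[OF degree_monom_le])
  \<comment> \<open>The value at \<open>0\<close> certifies that \<open>G\<close> is not the zero
    polynomial, as the root bound requires.\<close>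
  have G1: "poly G 0 = 1"
  proof -
    have "poly G 0 = (\<Sum>i<c. 0 ^ (e * i))"
      by (simp add: G_def poly_sum poly_monom)
    also have "\<dots> = (\<Sum>i\<in>{0}. 0 ^ (e * i))"
      using c0 e by (intro sum.mono_neutral_right) auto
    finally show ?thesis by simp
  qed
  then have G: "G \<noteq> 0" by auto
  have Hp: "poly H x = x ^ e - 1" for x by (simp add: H_def poly_monom)
  have "degree H \<le> e" unfolding H_def
    by (intro degree_diff_le) (auto simp: degree_monom_le)
  moreover have H: "H \<noteq> 0"
  proof
    assume "H = 0" then have "poly H 0 = 0" by simp
    then show False using e by (simp add: Hp power_0_left)
  qed
  ultimately have le: "card {x :: 'a. x ^ e = 1} \<le> e"
    using card_poly_roots_bound[OF H] by (simp add: Hp)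
  have "UNIV - {0} \<subseteq> {x :: 'a. x ^ e = 1} \<union> {x. poly G x = 0}"
  proof
    fix x :: 'a assume x: "x \<in> UNIV - {0}"
    have "(x ^ e - 1) * poly G x = (x ^ e) ^ c - 1"
      by (simp add: G_def poly_sum poly_monom power_mult power_diff_1_eq)
    also have "\<dots> = 0" using x power_card_minus_1[of x] c by (simp add: q_def power_mult)
    finally show "x \<in> {x :: 'a. x ^ e = 1} \<union> {x. poly G x = 0}" by auto
  qed
  then have "card (UNIV - {0 :: 'a}) \<le> card ({x :: 'a. x ^ e = 1} \<union> {x. poly G x = 0})"
    by (intro card_mono) auto
  also have "\<dots> \<le> card {x :: 'a. x ^ e = 1} + card {x. poly G x = 0}" by (rule card_Un_le)
  also have "card {x. poly G x = 0} \<le> e * (c - 1)"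
    using card_poly_roots_bound[OF G] degG by linarith
  finally have "e * c \<le> card {x :: 'a. x ^ e = 1} + e * (c - 1)" using c by (simp add: q_def)
  moreover have "e * c = e + e * (c - 1)" using c0 by (cases c) auto
  ultimately show ?thesis using le by linarith
qed

text \<open>Multiplication by \<open>p' / p\<close> moves fibres of the power map onto each other,
  so each nonempty fibre is as large as the one over \<open>1\<close>, the \<open>e\<close>-th roots
  of unity.\<close>

lemma card_nonzero_powers:
  fixes e :: nat
  assumes "e dvd card (UNIV :: 'a::{field,finite} set) - 1"
  shows "e * card ((\<lambda>x :: 'a. x ^ e) ` (UNIV - {0})) = card (UNIV :: 'a set) - 1"
    and "z \<in> (\<lambda>x :: 'a. x ^ e) ` (UNIV - {0}) \<Longrightarrow> card {x. x \<noteq> 0 \<and> x ^ e = z} = e"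
proof -
  let ?P = "UNIV - {0 :: 'a}"
  have e: "e > 0" using assms card_field_gt_1[where 'a = 'a] by (auto intro!: Nat.gr0I)
  have fib: "card {x\<in>?P. x ^ e \<in> Y} * card ((\<lambda>x. x ^ e) ` ?P) = card ?P * card (Y \<inter> (\<lambda>x. x ^ e) ` ?P)" for Y
  proof (rule card_fibers_action, simp)
    fix p p' :: 'a assume "p \<in> ?P" "p' \<in> ?P"
    then show "\<exists>\<psi>. inj_on \<psi> ?P \<and> (\<forall>r\<in>?P. \<psi> r \<in> ?P \<and> (r ^ e = p ^ e \<longrightarrow> \<psi> r ^ e = p' ^ e))"
      by (intro exI[of _ "\<lambda>r. r * (p' / p)"]) (auto simp: inj_on_def power_mult_distrib power_divide)
  qed
  have "{x\<in>?P. x ^ e \<in> {1}} = {x. x ^ e = 1}" using e by (auto simp: power_0_left)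
  moreover have "{1} \<inter> (\<lambda>x. x ^ e) ` ?P = {1}"
    by (auto intro!: image_eqI[of _ _ 1])
  ultimately show eq: "e * card ((\<lambda>x :: 'a. x ^ e) ` ?P) = card (UNIV :: 'a set) - 1"
    using fib[of "{1}"] card_roots_of_unity[OF assms] by simp
  assume "z \<in> (\<lambda>x :: 'a. x ^ e) ` ?P"
  then have "{z} \<inter> (\<lambda>x. x ^ e) ` ?P = {z}" by auto
  then have "card {x. x \<noteq> 0 \<and> x ^ e = z} * card ((\<lambda>x. x ^ e) ` ?P) = e * card ((\<lambda>x :: 'a. x ^ e) ` ?P)"
    using fib[of "{z}"] eq by simp
  moreover have "card ((\<lambda>x :: 'a. x ^ e) ` ?P) > 0"
    using eq card_field_gt_1[where 'a = 'a] by (intro Nat.gr0I) auto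
  ultimately show "card {x. x \<noteq> 0 \<and> x ^ e = z} = e" by (auto simp only: mult_cancel2 less_irrefl)
qed

section \<open>The quadratic character\<close>

lemma eta_0 [simp]: "eta 0 = 0" and eta_1 [simp]: "eta 1 = 1"
  by (auto simp: eta_def intro!: exI[of _ 1])

context
  assumes odd_q: "odd (card (UNIV :: 'a::{field,finite} set))"
begin

lemma card_square_roots: "real (card {x :: 'a. x ^ 2 = z}) = 1 + eta z"
proof (cases "z = 0")
  case False
  have eq: "{x :: 'a. x ^ 2 = z} = {x. x \<noteq> 0 \<and> x ^ 2 = z}" using False by auto
  show ?thesis
  proof (cases "\<exists>y. y ^ 2 = z")
    case True
    then have "z \<in> (\<lambda>x :: 'a. x ^ 2) ` (UNIV - {0})" using False by auto
    then have "card {x. x \<noteq> 0 \<and> x ^ 2 = z} = 2" using odd_q by (intro card_nonzero_powers) auto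
    then show ?thesis using eq True False by (simp add: eta_def)
  next
    case no: False
    then have "{x :: 'a. x ^ 2 = z} = {}" by auto
    with no False show ?thesis by (simp add: eta_def)
  qed
qed auto

text \<open>Every element has exactly one square, so the numbers \<open>1 + eta z\<close> of square
  roots add up to the size of the field.\<close>

lemma sum_eta: "(\<Sum>x\<in>UNIV. eta (x :: 'a)) = 0"
proof -
  have "real (card (UNIV :: 'a set)) = (\<Sum>z\<in>UNIV. real (card {x :: 'a. x ^ 2 = z}))"
    by (subst sum.group[where g = "\<lambda>x :: 'a. x^2" and h = "\<lambda>_. 1 :: real" and S = UNIV and T = UNIV, simplified, symmetric])
       simp_all
  also have "\<dots> = real (card (UNIV :: 'a set)) + (\<Sum>x\<in>UNIV. eta (x :: 'a))"
    by (simp add: card_square_roots sum.distrib)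
  finally show ?thesis by simp
qed

text \<open>Only the product of two nonsquares is delicate. As \<open>sum_eta\<close> makes nonzero
  squares and nonsquares equally numerous, multiplication by a nonsquare \<open>x\<close> maps the
  former onto the latter; hence \<open>y = x * s\<close> with \<open>s\<close> a square, and
  \<open>x * y = x ^ 2 * s\<close>.\<close>

lemma eta_mult: "eta (x * y :: 'a) = eta x * eta y"
proof (cases "x = 0 \<or> y = 0")
  case False
  define sq where "sq = (\<lambda>z :: 'a. \<exists>y. y ^ 2 = z)"
  have sq_mult: "sq (u * v)" if "sq u" "sq v" for u v
    using that by (auto simp: sq_def simp flip: power_mult_distrib)
  have sq_mult_iff: "sq (u * v) \<longleftrightarrow> sq v" if "sq u" "u \<noteq> 0" for u v
  proof
    assume uv: "sq (u * v)"
    from that obtain w where "u = w ^ 2" by (auto simp: sq_def)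
    then have "sq (inverse u)" by (auto simp: sq_def simp flip: power_inverse)
    with uv have "sq (inverse u * (u * v))" using sq_mult by blast
    then show "sq v" using that by (simp flip: mult.assoc)
  qed (use that sq_mult in auto)
  have eta: "eta z = (if sq z then 1 else -1)" if "z \<noteq> 0" for z :: 'a
    using that by (auto simp: eta_def sq_def)
  define S N where "S = {z :: 'a. z \<noteq> 0 \<and> sq z}" and "N = {z :: 'a. z \<noteq> 0 \<and> \<not> sq z}"
  have "(\<Sum>x\<in>UNIV. eta (x :: 'a)) = (\<Sum>x\<in>S \<union> N. eta x)"
    by (rule sum.mono_neutral_right) (auto simp: S_def N_def)
  also have "\<dots> = (\<Sum>x\<in>S. eta x) + (\<Sum>x\<in>N. eta x)"
    by (rule sum.union_disjoint) (auto simp: S_def N_def)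
  also have "\<dots> = real (card S) - real (card N)"
    by (simp add: S_def N_def eta)
  finally have card: "card S = card N" by (simp add: sum_eta)
  have nonsq: "sq (x * y)" if "\<not> sq x" "\<not> sq y"
  proof -
    have inj: "inj_on ((*) x) S" using False by (auto simp: inj_on_def)
    have "(*) x ` S \<subseteq> N" using False that sq_mult_iff by (auto simp: S_def N_def mult.commute[of x])
    then have "(*) x ` S = N" using card card_image[OF inj] by (intro card_subset_eq) auto
    moreover have "y \<in> N" using that False by (auto simp: N_def)
    ultimately obtain s where "y = x * s" "sq s" by (auto simp: S_def)
    then have "x * y = x ^ 2 * s" by (simp add: power2_eq_square)
    then show ?thesis using sq_mult \<open>sq s\<close> by (auto simp: sq_def)
  qed
  show ?thesis using False nonsq sq_mult_iff[of x y] sq_mult_iff[of y x]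
    by (auto simp: eta mult.commute)
qed auto

lemma eta_prod: "eta (\<Prod>i\<in>A. f i :: 'a) = (\<Prod>i\<in>A. eta (f i))"
  by (induction A rule: infinite_finite_induct) (auto simp: eta_mult)

lemma eta_power: "eta (x ^ i :: 'a) = eta x ^ i"
  by (induction i) (auto simp: eta_mult)

lemma eta_square: "x \<noteq> 0 \<Longrightarrow> eta (x :: 'a) * eta x = 1"
  by (auto simp: eta_def)

text \<open>Pulling \<open>y ^ 2\<close> out turns the summand into \<open>eta (c / y - 1)\<close>.
  For \<open>c = 0\<close> all of these equal \<open>eta (-1)\<close>; otherwise
  \<open>c / y - 1\<close> runs through everything except \<open>-1\<close>, and
  \<open>sum_eta\<close> applies.\<close>

lemma eta_convolution:
  "(\<Sum>y\<in>UNIV. eta y * eta (c - y :: 'a)) =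
     eta (-1 :: 'a) * (real (card (UNIV :: 'a set)) * of_bool (c = 0) - 1)"
proof -
  have 1: "(\<Sum>y\<in>UNIV. eta y * eta (c - y)) = (\<Sum>y\<in>UNIV-{0}. eta y * eta (c - y))"
    by (rule sum.mono_neutral_right) auto
  have eq: "eta y * eta (c - y) = eta (c / y - 1)" if "y \<noteq> 0" for y
  proof -
    have "c - y = y * (c / y - 1)" using that by (simp add: field_simps)
    then have "eta y * eta (c - y) = eta y * eta y * eta (c / y - 1)"
      by (metis eta_mult mult.assoc)
    then show ?thesis using eta_square[OF that] by simp
  qed
  have 2: "(\<Sum>y\<in>UNIV. eta y * eta (c - y)) = (\<Sum>y\<in>UNIV-{0}. eta (c / y - 1))"
    unfolding 1 by (rule sum.cong) (simp_all add: eq)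
  show ?thesis
  proof (cases "c = 0")
    case True
    have "card (UNIV :: 'a set) > 1" by (rule card_field_gt_1)
    then show ?thesis using True 2 by (simp add: of_nat_diff)
  next
    case False
    have "(\<Sum>y\<in>UNIV-{0}. eta (c / y - 1)) = (\<Sum>z\<in>UNIV-{-1}. eta (z :: 'a))"
      using False
      by (intro sum.reindex_bij_witness[where i = "\<lambda>z. c / (z + 1)" and j = "\<lambda>y. c / y - 1"])
         (auto simp: field_simps add_eq_0_iff2)
    also have "\<dots> = (\<Sum>z\<in>UNIV. eta (z :: 'a)) - eta (-1 :: 'a)"
      by (simp add: sum_diff1)
    finally show ?thesis using 2 False by (simp add: sum_eta)
  qed
qed

end

section \<open>Additive convolution of weights\<close>

text \<open>Expand the product of the factors \<open>- \<beta> i + \<gamma> i * X\<close> over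
  \<open>S\<close> modulo \<open>X ^ 2 = e\<close>: \<open>p = True\<close> gives the constant
  coefficient, \<open>p = False\<close> the coefficient of \<open>X\<close>.\<close>

definition weight_sum :: "('i \<Rightarrow> real) \<Rightarrow> ('i \<Rightarrow> real) \<Rightarrow> real \<Rightarrow> 'i set \<Rightarrow> bool \<Rightarrow> real" where
  "weight_sum \<beta> \<gamma> e S p =
     (\<Sum>T | T \<subseteq> S \<and> even (card T) = p. (\<Prod>i\<in>T. \<gamma> i) * (\<Prod>i\<in>S-T. - \<beta> i) * e ^ (card T div 2))"

lemma weight_sum_empty:
  fixes \<beta> \<gamma> :: "'i \<Rightarrow> real"
  shows "weight_sum \<beta> \<gamma> e {} p = of_bool p"
proof -
  have "{T :: 'i set. T \<subseteq> {} \<and> even (card T) = p} = (if p then {{}} else {})" by auto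
  then show ?thesis unfolding weight_sum_def by (simp only:) simp
qed

text \<open>This multiplies by one further factor \<open>- \<beta> i + \<gamma> i * X\<close>;
  subsets that contain \<open>i\<close> come from subsets of the opposite parity.\<close>

lemma weight_sum_insert:
  assumes "finite S" "i \<notin> S"
  shows "weight_sum \<beta> \<gamma> e (insert i S) p =
    - \<beta> i * weight_sum \<beta> \<gamma> e S p + \<gamma> i * (if p then e else 1) * weight_sum \<beta> \<gamma> e S (\<not> p)"
proof -
  let ?w = "\<lambda>S T. (\<Prod>i\<in>T. \<gamma> i) * (\<Prod>i\<in>S-T. - \<beta> i) * e ^ (card T div 2)"
  let ?A = "\<lambda>p. {T. T \<subseteq> S \<and> even (card T) = p}"
  have fin: "finite T" if "T \<subseteq> S" for T using that assms finite_subset by blast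
  have cI: "card (insert i T) = Suc (card T)" if "T \<subseteq> S" for T
    using fin[OF that] that assms by (subst card_insert_disjoint) auto
  have "{T. T \<subseteq> insert i S \<and> even (card T) = p} = ?A p \<union> insert i ` ?A (\<not> p)" (is "?L = ?R")
  proof
    show "?L \<subseteq> ?R"
    proof
      fix T assume T: "T \<in> ?L"
      show "T \<in> ?R"
      proof (cases "i \<in> T")
        case True
        then have "T = insert i (T - {i})" "T - {i} \<subseteq> S" using T by auto
        then show ?thesis using T cI[of "T - {i}"] by (auto simp: image_iff intro!: exI[of _ "T - {i}"])
      qed (use T in auto)
    qed
    show "?R \<subseteq> ?L" by (auto simp: cI)
  qed
  moreover have "?A p \<inter> insert i ` ?A (\<not> p) = {}" using assms by auto
  ultimately have "weight_sum \<beta> \<gamma> e (insert i S) p =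
      (\<Sum>T\<in>?A p. ?w (insert i S) T) + (\<Sum>T\<in>insert i ` ?A (\<not> p). ?w (insert i S) T)"
    using assms(1) by (simp add: weight_sum_def sum.union_disjoint)
  also have "(\<Sum>T\<in>?A p. ?w (insert i S) T) = (\<Sum>T\<in>?A p. - \<beta> i * ?w S T)"
  proof (rule sum.cong[OF refl])
    fix T assume "T \<in> ?A p"
    then have "insert i S - T = insert i (S - T)" "i \<notin> S - T" using assms by auto
    then show "?w (insert i S) T = - \<beta> i * ?w S T" using assms by simp
  qed
  also have "(\<Sum>T\<in>insert i ` ?A (\<not> p). ?w (insert i S) T) = (\<Sum>T\<in>?A (\<not> p). ?w (insert i S) (insert i T))"
    using assms(2) by (subst sum.reindex) (auto simp: inj_on_def)
  also have "\<dots> = (\<Sum>T\<in>?A (\<not> p). \<gamma> i * (if p then e else 1) * ?w S T)"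
  proof (rule sum.cong[OF refl])
    fix T assume T: "T \<in> ?A (\<not> p)"
    then have "i \<notin> T" "finite T" using assms fin by auto
    moreover have "insert i S - insert i T = S - T" using assms by auto
    \<comment> \<open>Adding \<open>i\<close> raises the halved cardinality only if
      \<open>card T\<close> is odd, that is, if the new parity \<open>p\<close> is even.\<close>
    moreover have "e ^ (card (insert i T) div 2) = (if p then e else 1) * e ^ (card T div 2)"
      using T cI[of T] by (auto elim!: oddE)
    ultimately show "?w (insert i S) (insert i T) = \<gamma> i * (if p then e else 1) * ?w S T"
      by (simp add: mult_ac)
  qed
  finally show ?thesis by (simp add: weight_sum_def sum_distrib_left)
qed

text \<open>Fixing the value \<open>y\<close> of the new coordinate gives the recursion that makes
  solution counts iterated convolutions.\<close>

lemma card_PiE_insert_sum: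
  fixes f :: "'i \<Rightarrow> 'b \<Rightarrow> 'a::ab_group_add"
  assumes "finite S" "i \<notin> S" and A: "\<And>j. j \<in> insert i S \<Longrightarrow> finite (A j)"
  shows "card {x \<in> PiE (insert i S) A. (\<Sum>j\<in>insert i S. f j (x j)) = c} =
    (\<Sum>y\<in>A i. card {x \<in> PiE S A. (\<Sum>j\<in>S. f j (x j)) = c - f i y})"
proof -
  let ?B = "\<lambda>y. {x \<in> PiE S A. (\<Sum>j\<in>S. f j (x j)) = c - f i y}"
  have sum: "(\<Sum>j\<in>insert i S. f j ((x(i := y)) j)) = f i y + (\<Sum>j\<in>S. f j (x j))" for x y
  proof -
    have "(\<Sum>j\<in>S. f j ((x(i := y)) j)) = (\<Sum>j\<in>S. f j (x j))"
      by (rule sum.cong) (use assms in auto)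
    then show ?thesis using assms by simp
  qed
  have "{x \<in> PiE (insert i S) A. (\<Sum>j\<in>insert i S. f j (x j)) = c} =
      (\<lambda>(y, g). g(i := y)) ` (SIGMA y:A i. ?B y)"
    unfolding PiE_insert_eq by (auto simp: sum image_iff algebra_simps simp del: fun_upd_apply)
  also have "card \<dots> = card (SIGMA y:A i. ?B y)"
    by (intro card_image inj_on_subset[OF inj_combinator[OF assms(2), of A]]) auto
  also have "\<dots> = (\<Sum>y\<in>A i. card (?B y))"
    using assms by (intro card_SigmaI) (auto intro!: finite_subset[OF _ finite_PiE[of S A]])
  finally show ?thesis .
qed

text \<open>The span of \<open>1\<close>, \<open>q \<delta>\<^sub>0 - 1\<close> and \<open>\<chi>\<close> is closed under additive convolution,
  so adding one variable at a time acts linearly on these three coordinates.\<close>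

lemma card_additive_solutions:
  fixes f :: "'i \<Rightarrow> 'b \<Rightarrow> 'a::{ab_group_add,finite}" and \<chi> :: "'a \<Rightarrow> real"
  defines "q \<equiv> real (card (UNIV :: 'a set))"
  assumes fin: "finite S" and A: "\<And>i. i \<in> S \<Longrightarrow> finite (A i)"
    and g: "\<And>i z. i \<in> S \<Longrightarrow>
      real (card {x \<in> A i. f i x = z}) = 1 - \<beta> i * of_bool (z = 0) + \<gamma> i * \<chi> z"
    and \<chi>0: "\<chi> 0 = 0" and sum_\<chi>: "(\<Sum>z\<in>UNIV. \<chi> z) = 0"
    and conv: "\<And>c. (\<Sum>y\<in>UNIV. \<chi> y * \<chi> (c - y)) = \<epsilon> * (q * of_bool (c = 0) - 1)"
  shows "q * real (card {x \<in> PiE S A. (\<Sum>i\<in>S. f i (x i)) = c}) =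
    (\<Prod>i\<in>S. q - \<beta> i) + weight_sum \<beta> \<gamma> (\<epsilon> * q) S True * (q * of_bool (c = 0) - 1)
      + q * weight_sum \<beta> \<gamma> (\<epsilon> * q) S False * \<chi> c"
  using fin A g
proof (induction S arbitrary: c rule: finite_induct)
  case empty
  then show ?case by (auto simp: weight_sum_empty)
next
  case (insert i S)
  \<comment> \<open>By induction \<open>P\<close>, \<open>U\<close> and \<open>q * V\<close> are the
    coordinates of the scaled count with respect to \<open>1\<close>, \<open>D\<close> and
    \<open>\<chi>\<close>; \<open>G\<close> below is the fibre size function of the new
    variable.\<close>
  define P U V where "P = (\<Prod>i\<in>S. q - \<beta> i)" and "U = weight_sum \<beta> \<gamma> (\<epsilon> * q) S True"
    and "V = weight_sum \<beta> \<gamma> (\<epsilon> * q) S False"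
  define G where "G = (\<lambda>z. 1 - \<beta> i * of_bool (z = 0) + \<gamma> i * \<chi> z)"
  define D :: "'a \<Rightarrow> real" where "D = (\<lambda>z. q * of_bool (z = 0) - 1)"
  have sumG: "(\<Sum>z\<in>UNIV. G z) = q - \<beta> i"
    by (simp add: G_def sum.distrib sum_subtractf sum_\<chi> q_def of_bool_def sum.delta flip: sum_distrib_left)
  \<comment> \<open>The delta part of \<open>D\<close> reproduces \<open>q * G c\<close> and its
    constant part removes the total mass of \<open>G\<close>, so no multiple of \<open>1\<close> is
    left.\<close>
  have sumGD: "(\<Sum>z\<in>UNIV. G z * D (c - z)) = - \<beta> i * D c + q * \<gamma> i * \<chi> c"
  proof -
    have "(\<Sum>z\<in>UNIV. G z * D (c - z)) = q * (\<Sum>z\<in>UNIV. if c = z then G z else 0) - (\<Sum>z\<in>UNIV. G z)"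
      unfolding sum_distrib_left sum_subtractf[symmetric]
      by (rule sum.cong) (auto simp: D_def algebra_simps)
    also have "\<dots> = q * G c - (q - \<beta> i)" by (simp add: sumG)
    also have "\<dots> = - \<beta> i * D c + q * \<gamma> i * \<chi> c" by (simp add: G_def D_def algebra_simps)
    finally show ?thesis .
  qed
  have sum_shift: "(\<Sum>z\<in>UNIV. \<chi> (c - z)) = 0"
    using sum.reindex_bij_witness[of UNIV "\<lambda>z. c - z" "\<lambda>z. c - z" UNIV \<chi> "\<lambda>z. \<chi> (c - z)"] sum_\<chi> by simp
  have sumG\<chi>: "(\<Sum>z\<in>UNIV. G z * \<chi> (c - z)) = - \<beta> i * \<chi> c + \<gamma> i * \<epsilon> * D c"
  proof -
    have "(\<Sum>z\<in>UNIV. G z * \<chi> (c - z)) = (\<Sum>z\<in>UNIV. \<chi> (c - z))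
        - \<beta> i * (\<Sum>z\<in>UNIV. if z = 0 then \<chi> (c - z) else 0) + \<gamma> i * (\<Sum>z\<in>UNIV. \<chi> z * \<chi> (c - z))"
      unfolding sum_distrib_left sum_subtractf[symmetric] sum.distrib[symmetric]
      by (rule sum.cong) (auto simp: G_def algebra_simps)
    then show ?thesis by (simp add: sum_shift conv D_def)
  qed
  have IH: "q * real (card {x \<in> PiE S A. (\<Sum>i\<in>S. f i (x i)) = c}) = P + U * D c + q * V * \<chi> c" for c
    using insert.IH[of c] insert.prems unfolding P_def U_def V_def D_def by blast
  have "q * real (card {x \<in> PiE (insert i S) A. (\<Sum>j\<in>insert i S. f j (x j)) = c}) =
      (\<Sum>y\<in>A i. P + U * D (c - f i y) + q * V * \<chi> (c - f i y))"
    using insert by (subst card_PiE_insert_sum) (auto simp: sum_distrib_left IH)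
  \<comment> \<open>Grouping by the value \<open>z\<close> of \<open>f i y\<close> replaces the sum
    over \<open>A i\<close> by a convolution with \<open>G\<close>.\<close>
  also have "\<dots> = (\<Sum>z\<in>UNIV. \<Sum>y\<in>{y\<in>A i. f i y = z}. P + U * D (c - f i y) + q * V * \<chi> (c - f i y))"
    using insert.prems(1)[of i] by (subst sum.group) auto
  also have "\<dots> = (\<Sum>z\<in>UNIV. G z * (P + U * D (c - z) + q * V * \<chi> (c - z)))"
    using insert.prems(2)[of i] by (intro sum.cong) (auto simp: G_def)
  also have "\<dots> = P * (\<Sum>z\<in>UNIV. G z) + U * (\<Sum>z\<in>UNIV. G z * D (c - z))
      + q * V * (\<Sum>z\<in>UNIV. G z * \<chi> (c - z))"
    unfolding sum_distrib_left sum.distrib[symmetric] by (rule sum.cong) (auto simp: algebra_simps)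
  also have "\<dots> = P * (q - \<beta> i) + (- \<beta> i * U + \<gamma> i * (\<epsilon> * q) * V) * D c
      + q * (- \<beta> i * V + \<gamma> i * U) * \<chi> c"
    unfolding sumG sumGD sumG\<chi> by (simp add: algebra_simps)
  finally show ?case
    using insert(1,2) by (simp add: weight_sum_insert P_def U_def V_def D_def mult_ac)
qed

text \<open>\<open>B\<close> selects the nonzero elements or the whole field. The right-hand side
  has the shape that \<open>card_additive_solutions\<close> expects, with
  \<open>\<gamma> i = 0\<close>.\<close>

lemma card_linear_fiber:
  fixes a z :: "'a::{field,finite}"
  assumes "a \<noteq> 0"
  shows "real (card {x\<in>UNIV - (if B then {0} else {}). a * x ^ 1 = z}) = 1 - of_bool B * of_bool (z = 0)"
proof -
  have "{x\<in>UNIV - (if B then {0} else {}). a * x ^ 1 = z} = (if B \<and> z = 0 then {} else {z / a})"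
    using assms by (auto simp: field_simps)
  then show ?thesis by simp
qed

lemma card_quadratic_fiber:
  fixes a z :: "'a::{field,finite}"
  assumes "odd (card (UNIV :: 'a set))" "a \<noteq> 0"
  shows "real (card {x\<in>UNIV - (if B then {0} else {}). a * x ^ 2 = z}) =
    1 - of_bool B * of_bool (z = 0) + eta a * eta z"
proof -
  have eta: "eta (z / a) = eta a * eta z"
  proof -
    have "eta z = eta a * eta (z / a)" using assms eta_mult[OF assms(1), of a "z / a"] by simp
    then have "eta a * eta z = (eta a * eta a) * eta (z / a)" by simp
    then show ?thesis using eta_square[of a] assms by simp
  qed
  show ?thesis
  proof (cases "z = 0")
    case True
    then have "{x\<in>UNIV - (if B then {0} else {}). a * x ^ 2 = z} = (if B then {} else {0})"
      using assms by auto
    then show ?thesis using True by simp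
  next
    case False
    then have "{x\<in>UNIV - (if B then {0} else {}). a * x ^ 2 = z} = {x. x ^ 2 = z / a}"
      using assms by (auto simp: field_simps)
    then show ?thesis using False card_square_roots[OF assms(1), of "z / a"] eta by simp
  qed
qed

section \<open>Zeros of diagonal forms on the torus\<close>

text \<open>By Bezout the gcd is a multiple of \<open>m\<close> plus a multiple of
  \<open>q - 1\<close>, and the latter does not affect powers of \<open>w\<close>.\<close>

lemma gcd_power_is_power:
  fixes w :: "'a::{field,finite}"
  assumes "w \<noteq> 0"
  obtains v where "v \<noteq> 0" "w ^ gcd m (card (UNIV :: 'a set) - 1) = v ^ m"
proof -
  define r where "r = card (UNIV :: 'a set) - 1"
  obtain u v where uv: "u * int m + v * int r = gcd (int m) (int r)" using bezout_int by blast
  have "w ^ gcd m r = w powi (u * int m + v * int r)" unfolding uv by (simp flip: power_int_of_nat)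
  also have "\<dots> = (w powi u) ^ m * w powi (int r * v)"
    using assms by (simp add: power_int_add power_int_mult mult.commute)
  also have "w powi (int r * v) = 1" using powi_card_minus_1[OF assms] by (simp add: r_def)
  finally show ?thesis using that[of "w powi u"] assms by (simp add: r_def)
qed

text \<open>The Chinese remainder theorem, written multiplicatively.\<close>

lemma common_coset_representative:
  fixes z :: "'i \<Rightarrow> 'a::field" and e :: "'i \<Rightarrow> nat"
  assumes "finite J" "\<And>i. i \<in> J \<Longrightarrow> z i \<noteq> 0"
    and "\<And>i j. i \<in> J \<Longrightarrow> j \<in> J \<Longrightarrow> i \<noteq> j \<Longrightarrow> coprime (e i) (e j)"
  shows "\<exists>\<tau>. \<tau> \<noteq> 0 \<and> (\<forall>i\<in>J. \<exists>w. w \<noteq> 0 \<and> z i = \<tau> * w ^ e i)"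
  using assms
proof (induction J rule: finite_induct)
  case empty
  then show ?case by (auto intro: exI[of _ 1])
next
  case (insert i J)
  obtain \<tau> where \<tau>: "\<tau> \<noteq> 0" "\<And>j. j \<in> J \<Longrightarrow> \<exists>w. w \<noteq> 0 \<and> z j = \<tau> * w ^ e j"
    using insert.IH insert.prems by (metis insert_iff)
  define E where "E = (\<Prod>j\<in>J. e j)"
  have "coprime E (e i)"
    unfolding E_def using insert by (intro prod_coprime_left) auto
  \<comment> \<open>Bezout splits \<open>z i / \<tau>\<close> into an \<open>E\<close>-th power, to
    be absorbed into \<open>\<tau>\<close>, and an \<open>e i\<close>-th power. The absorbed factor
    is an \<open>e j\<close>-th power for every \<open>j\<close> in \<open>J\<close>, so the earlier
    representations survive.\<close>
  then obtain u v where uv: "u * int E + v * int (e i) = 1"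
    using bezout_int[of "int E" "int (e i)"] by auto
  define r where "r = z i / \<tau>"
  have r: "r \<noteq> 0" using \<tau> insert.prems(1)[of i] by (simp add: r_def)
  have "r = r powi (u * int E + v * int (e i))" by (simp add: uv)
  also have "\<dots> = (r powi u) ^ E * (r powi v) ^ e i"
    using r by (simp add: power_int_add power_int_mult)
  finally have zi: "z i = (\<tau> * (r powi u) ^ E) * (r powi v) ^ e i"
    using \<tau> by (simp add: r_def field_simps)
  show ?case
  proof (rule exI[of _ "\<tau> * (r powi u) ^ E"], intro conjI ballI)
    fix j assume "j \<in> insert i J"
    then consider "j = i" | "j \<in> J" by blast
    then show "\<exists>w. w \<noteq> 0 \<and> z j = \<tau> * (r powi u) ^ E * w ^ e j"
    proof cases
      case 1
      then show ?thesis using zi r by (intro exI[of _ "r powi v"]) auto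
    next
      case 2
      then obtain c where c: "E = e j * c" unfolding E_def using insert(1) by (metis dvd_def dvd_prodI)
      obtain w where w: "w \<noteq> 0" "z j = \<tau> * w ^ e j" using \<tau>(2) 2 by blast
      let ?s = "(r powi u) ^ c"
      have "(r powi u) ^ E = ?s ^ e j" by (simp add: c power_mult mult.commute)
      then show ?thesis using w r
        by (intro exI[of _ "w / ?s"]) (auto simp: power_divide)
    qed
  qed (use \<tau> r in auto)
qed

text \<open>The common scalar \<open>s\<close> is harmless because the zero set of a linear form is
  stable under scaling, and it makes the image large enough to depend only on parities.\<close>

definition torus_image :: "'i set \<Rightarrow> ('i \<Rightarrow> nat) \<Rightarrow> ('i \<Rightarrow> 'a::field) set" where
  "torus_image S m = (\<lambda>(s, x). \<lambda>j\<in>S. s * x j ^ m j) ` ((UNIV - {0}) \<times> PiE S (\<lambda>_. UNIV - {0}))"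

lemma torus_imageI:
  assumes "s \<noteq> 0" "\<And>j. j \<in> S \<Longrightarrow> \<exists>v. v \<noteq> 0 \<and> y j = s * v ^ m j" "y \<in> extensional S"
  shows "y \<in> torus_image S m"
proof -
  obtain v where v: "\<And>j. j \<in> S \<Longrightarrow> v j \<noteq> 0 \<and> y j = s * v j ^ m j" using assms(2) by metis
  have "y = (\<lambda>j\<in>S. s * restrict v S j ^ m j)"
    by (rule extensionalityI[OF assms(3)]) (auto simp: v)
  moreover have "restrict v S \<in> PiE S (\<lambda>_. UNIV - {0})" using v by auto
  ultimately show ?thesis using assms(1) unfolding torus_image_def
    by (intro image_eqI[of _ _ "(s, restrict v S)"]) auto
qed

text \<open>Only the parities of the exponents \<open>gcd (m j) (q - 1)\<close> matter for the torus image: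
  after a square has been split off, the remaining exponents are pairwise coprime.\<close>

lemma torus_image_parity:
  fixes m :: "'i \<Rightarrow> nat" and T :: "'i set"
  defines "d \<equiv> (\<lambda>j. gcd (m j) (card (UNIV :: 'a::{field,finite} set) - 1))"
  assumes S: "finite S"
    and odd: "\<And>j. j \<in> S \<Longrightarrow> j \<in> T \<Longrightarrow> odd (d j)" and even: "\<And>j. j \<in> S \<Longrightarrow> j \<notin> T \<Longrightarrow> even (d j)"
    and coprime: "\<And>i j. i \<in> S \<Longrightarrow> j \<in> S \<Longrightarrow> i \<noteq> j \<Longrightarrow>
      coprime (if i \<in> T then d i else d i div 2) (if j \<in> T then d j else d j div 2)"
  shows "torus_image S m = (torus_image S (\<lambda>j. if j \<in> T then 1 else 2) :: ('i \<Rightarrow> 'a) set)"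
proof (intro equalityI subsetI)
  fix y :: "'i \<Rightarrow> 'a" assume "y \<in> torus_image S m"
  then obtain s x where y: "y = (\<lambda>j\<in>S. s * x j ^ m j)" "s \<noteq> 0" "\<And>j. j \<in> S \<Longrightarrow> x j \<noteq> 0"
    by (auto simp: torus_image_def)
  show "y \<in> torus_image S (\<lambda>j. if j \<in> T then 1 else 2)"
  proof (rule torus_imageI[OF \<open>s \<noteq> 0\<close>])
    fix j assume j: "j \<in> S"
    show "\<exists>v. v \<noteq> 0 \<and> y j = s * v ^ (if j \<in> T then 1 else 2)"
    proof (cases "j \<in> T")
      case True
      then show ?thesis using y j by (intro exI[of _ "x j ^ m j"]) auto
    next
      case False
      then have "m j = m j div 2 * 2" using even[OF j] by (auto simp: d_def)
      then have "x j ^ m j = (x j ^ (m j div 2)) ^ 2" by (metis power_mult)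
      then show ?thesis using y j False by (intro exI[of _ "x j ^ (m j div 2)"]) auto
    qed
  qed (simp add: y)
next
  fix y :: "'i \<Rightarrow> 'a" assume "y \<in> torus_image S (\<lambda>j. if j \<in> T then 1 else 2)"
  then obtain s x where y: "y = (\<lambda>j\<in>S. s * x j ^ (if j \<in> T then 1 else 2))" "s \<noteq> 0" "\<And>j. j \<in> S \<Longrightarrow> x j \<noteq> 0"
    by (auto simp: torus_image_def)
  \<comment> \<open>The choice makes \<open>s * z j ^ 2\<close> agree with \<open>y j\<close> up to
    a \<open>d j\<close>-th power. Writing \<open>z j = \<tau> * w ^ e j\<close> then exhibits
    \<open>y j\<close> as \<open>s * \<tau> ^ 2\<close> times a \<open>d j\<close>-th power for all
    \<open>j\<close> at once.\<close>
  define z where "z = (\<lambda>j. if j \<in> T then x j ^ ((d j + 1) div 2) else x j)"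
  define e where "e = (\<lambda>j. if j \<in> T then d j else d j div 2)"
  obtain \<tau> where \<tau>: "\<tau> \<noteq> 0" "\<And>j. j \<in> S \<Longrightarrow> \<exists>w. w \<noteq> 0 \<and> z j = \<tau> * w ^ e j"
  proof -
    have "\<exists>\<tau>. \<tau> \<noteq> 0 \<and> (\<forall>j\<in>S. \<exists>w. w \<noteq> 0 \<and> z j = \<tau> * w ^ e j)"
      unfolding e_def using S coprime y(3) by (intro common_coset_representative) (auto simp: z_def)
    then show ?thesis using that by blast
  qed
  show "y \<in> torus_image S m"
  proof (rule torus_imageI[of "s * \<tau> ^ 2"])
    fix j assume j: "j \<in> S"
    then obtain w where w: "w \<noteq> 0" "z j = \<tau> * w ^ e j" using \<tau>(2) by blast
    have "\<exists>v. v \<noteq> 0 \<and> y j = s * \<tau> ^ 2 * v ^ d j"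
    proof (cases "j \<in> T")
      case True
      have "(d j + 1) div 2 * 2 = d j + 1" using odd[OF j True] by presburger
      then have "x j * x j ^ d j = z j ^ 2" using True by (simp add: z_def flip: power_mult)
      then have "x j * x j ^ d j = \<tau> ^ 2 * (w ^ 2) ^ d j"
        using w True by (simp add: e_def power_mult_distrib power2_eq_square)
      then show ?thesis using True w y j
        by (intro exI[of _ "w ^ 2 / x j"]) (auto simp: power_divide field_simps)
    next
      case False
      have "d j div 2 * 2 = d j" using even[OF j False] by auto
      then have "(w ^ (d j div 2)) ^ 2 = w ^ d j" by (metis power_mult)
      then show ?thesis using False w y j
        by (intro exI[of _ w]) (auto simp: z_def e_def power_mult_distrib)
    qed
    then obtain v where v: "v \<noteq> 0" "y j = s * \<tau> ^ 2 * v ^ d j" by blast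
    obtain u where "u \<noteq> 0" "v ^ d j = u ^ m j"
      using gcd_power_is_power[OF v(1)] unfolding d_def by blast
    then show "\<exists>v. v \<noteq> 0 \<and> y j = s * \<tau> ^ 2 * v ^ m j" using v by auto
  qed (use y \<tau> in auto)
qed

text \<open>The map from pairs \<open>(s, x)\<close> to the torus image has fibres of equal size,
  and by homogeneity the vanishing of the form can be read off the image. The factor
  \<open>q - 1\<close> from the choice of \<open>s\<close> cancels.\<close>

lemma card_torus_solutions:
  fixes a :: "'i \<Rightarrow> 'a::{field,finite}" and m :: "'i \<Rightarrow> nat"
  assumes S: "finite S"
  shows "card {x \<in> PiE S (\<lambda>_. UNIV - {0}). (\<Sum>j\<in>S. a j * x j ^ m j) = 0} * card (torus_image S m :: ('i \<Rightarrow> 'a) set) =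
    (card (UNIV :: 'a set) - 1) ^ card S * card ({y. (\<Sum>j\<in>S. a j * y j) = 0} \<inter> torus_image S m)"
proof -
  define X :: "('i \<Rightarrow> 'a) set" where "X = PiE S (\<lambda>_. UNIV - {0})"
  define h where "h = (\<lambda>(s :: 'a, x). \<lambda>j\<in>S. s * x j ^ m j)"
  define P where "P = (UNIV - {0 :: 'a}) \<times> X"
  have finX: "finite X" unfolding X_def using S by (intro finite_PiE) auto
  have "card {p \<in> P. h p \<in> {y. (\<Sum>j\<in>S. a j * y j) = 0}} * card (h ` P) =
    card P * card ({y. (\<Sum>j\<in>S. a j * y j) = 0} \<inter> h ` P)"
  proof (rule card_fibers_action)
    show "finite P" using finX by (simp add: P_def)
    fix p p' assume "p \<in> P" "p' \<in> P"
    then obtain s0 x0 s1 x1 where p: "p = (s0, x0)" "p' = (s1, x1)" "s0 \<noteq> 0" "s1 \<noteq> 0"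
        and x: "x0 \<in> X" "x1 \<in> X" by (auto simp: P_def)
    have x: "x0 j \<noteq> 0" "x1 j \<noteq> 0" if "j \<in> S" for j using x that by (auto simp: X_def)
    \<comment> \<open>This is the translation of the torus that takes \<open>p\<close> to
      \<open>p'\<close>.\<close>
    define \<psi> where "\<psi> = (\<lambda>(s, x). (s * (s1 / s0), \<lambda>j\<in>S. x j * (x1 j / x0 j)))"
    have "inj_on \<psi> P"
    proof (rule inj_onI)
      fix r r' assume r: "r \<in> P" "r' \<in> P" "\<psi> r = \<psi> r'"
      then have "fst r = fst r'" using p by (auto simp: \<psi>_def split_beta)
      moreover have "snd r j = snd r' j" if "j \<in> S" for j
        using r x[OF that] that by (auto simp: \<psi>_def split_beta dest: fun_cong[of _ _ j])
      then have "snd r = snd r'" using r by (intro PiE_ext[of _ S]) (auto simp: P_def X_def)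
      ultimately show "r = r'" by (rule prod_eqI)
    qed
    moreover have "\<psi> r \<in> P \<and> (h r = h p \<longrightarrow> h (\<psi> r) = h p')" if r: "r \<in> P" for r
    proof (intro conjI impI)
      show "\<psi> r \<in> P" using r p x by (auto simp: \<psi>_def P_def X_def)
      assume eq: "h r = h p"
      show "h (\<psi> r) = h p'"
      proof
        fix j
        show "h (\<psi> r) j = h p' j"
        proof (cases "j \<in> S")
          case True
          have "fst r * snd r j ^ m j = s0 * x0 j ^ m j"
            using fun_cong[OF eq, of j] True p by (simp add: h_def split_beta)
          then show ?thesis using True p x[OF True]
            by (simp add: h_def \<psi>_def split_beta power_mult_distrib power_divide field_simps)
        qed (simp add: h_def split_beta)
      qed
    qed
    ultimately show "\<exists>\<psi>. inj_on \<psi> P \<and> (\<forall>r\<in>P. \<psi> r \<in> P \<and> (h r = h p \<longrightarrow> h (\<psi> r) = h p'))" by blast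
  qed
  moreover have "h ` P = torus_image S m" by (simp add: h_def P_def X_def torus_image_def)
  moreover have "{p \<in> P. h p \<in> {y. (\<Sum>j\<in>S. a j * y j) = 0}} =
      (UNIV - {0}) \<times> {x \<in> X. (\<Sum>j\<in>S. a j * x j ^ m j) = 0}"
  proof -
    have "(\<Sum>j\<in>S. a j * h (s, x) j) = s * (\<Sum>j\<in>S. a j * x j ^ m j)" for s x
      unfolding sum_distrib_left by (rule sum.cong) (auto simp: h_def)
    then show ?thesis by (auto simp: P_def)
  qed
  moreover have "card X = (card (UNIV :: 'a set) - 1) ^ card S"
    using S by (simp add: X_def card_PiE)
  ultimately have "(card (UNIV :: 'a set) - 1) * (card {x \<in> X. (\<Sum>j\<in>S. a j * x j ^ m j) = 0} * card (torus_image S m :: ('i \<Rightarrow> 'a) set)) =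
    (card (UNIV :: 'a set) - 1) * ((card (UNIV :: 'a set) - 1) ^ card S * card ({y. (\<Sum>j\<in>S. a j * y j) = 0} \<inter> torus_image S m))"
    by (simp add: P_def card_cartesian_product mult.assoc)
  then show ?thesis using card_field_gt_1[where 'a = 'a] by (simp add: X_def)
qed

lemma card_torus_solutions_cong:
  fixes a :: "'i \<Rightarrow> 'a::{field,finite}" and m m' :: "'i \<Rightarrow> nat"
  assumes S: "finite S" and eq: "torus_image S m = (torus_image S m' :: ('i \<Rightarrow> 'a) set)"
  shows "card {x \<in> PiE S (\<lambda>_. UNIV - {0}). (\<Sum>j\<in>S. a j * x j ^ m j) = 0} =
    card {x \<in> PiE S (\<lambda>_. UNIV - {0}). (\<Sum>j\<in>S. a j * x j ^ m' j) = 0}"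
proof -
  have "(\<lambda>j\<in>S. 1) \<in> (torus_image S m :: ('i \<Rightarrow> 'a) set)"
    by (rule torus_imageI[of 1]) (auto intro: exI[of _ 1])
  then have "torus_image S m \<noteq> ({} :: ('i \<Rightarrow> 'a) set)" by blast
  moreover have "finite (torus_image S m :: ('i \<Rightarrow> 'a) set)"
    using S unfolding torus_image_def by (intro finite_imageI finite_cartesian_product finite_PiE) auto
  ultimately have "card (torus_image S m :: ('i \<Rightarrow> 'a) set) > 0" by (simp add: card_gt_0_iff)
  then show ?thesis
    using trans[OF card_torus_solutions[OF S, of a m] card_torus_solutions[OF S, of a m', folded eq, symmetric]]
    by (auto simp only: mult_cancel2 less_irrefl)
qed

text \<open>Sorting solutions by their nonzero coordinates carries torus comparisons over to the
  full space. Positive exponents make the zero coordinates contribute nothing, as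
  \<open>0 ^ 0\<close> would be \<open>1\<close>.\<close>

lemma card_solutions_by_support:
  fixes a :: "'i \<Rightarrow> 'a::{field,finite}" and m :: "'i \<Rightarrow> nat"
  assumes S: "finite S" and m: "\<And>j. j \<in> S \<Longrightarrow> m j > 0"
  shows "card {x \<in> PiE S (\<lambda>_. UNIV). (\<Sum>j\<in>S. a j * x j ^ m j) = 0} =
    (\<Sum>J\<in>Pow S. card {x \<in> PiE J (\<lambda>_. UNIV - {0}). (\<Sum>j\<in>J. a j * x j ^ m j) = 0})"
proof -
  define A where "A = {x \<in> PiE S (\<lambda>_. UNIV). (\<Sum>j\<in>S. a j * x j ^ m j) = 0}"
  define supp where "supp = (\<lambda>x :: 'i \<Rightarrow> 'a. {j \<in> S. x j \<noteq> 0})"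
  have finA: "finite A" unfolding A_def using S by (intro finite_subset[OF _ finite_PiE[of S "\<lambda>_. UNIV"]]) auto
  have "card A = (\<Sum>x\<in>A. 1)" by simp
  also have "\<dots> = (\<Sum>J\<in>Pow S. \<Sum>x\<in>{x\<in>A. supp x = J}. 1)"
    by (rule sum.group[symmetric]) (auto simp: finA S supp_def)
  also have "\<dots> = (\<Sum>J\<in>Pow S. card {x \<in> PiE J (\<lambda>_. UNIV - {0}). (\<Sum>j\<in>J. a j * x j ^ m j) = 0})"
  proof (rule sum.cong[OF refl])
    fix J assume "J \<in> Pow S"
    then have J: "J \<subseteq> S" by simp
    let ?B = "{x \<in> PiE J (\<lambda>_. UNIV - {0}). (\<Sum>j\<in>J. a j * x j ^ m j) = 0}"
    let ?ext = "\<lambda>x. \<lambda>j\<in>S. if j \<in> J then x j else 0"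
    have sum1: "(\<Sum>j\<in>S. a j * x j ^ m j) = (\<Sum>j\<in>J. a j * x j ^ m j)" if "supp x = J" for x
      by (rule sum.mono_neutral_right) (use S J m that in \<open>auto simp: supp_def zero_power\<close>)
    have sum2: "(\<Sum>j\<in>S. a j * ?ext x j ^ m j) = (\<Sum>j\<in>J. a j * x j ^ m j)" for x
    proof -
      have "(\<Sum>j\<in>S. a j * ?ext x j ^ m j) = (\<Sum>j\<in>J. a j * ?ext x j ^ m j)"
        by (rule sum.mono_neutral_right) (use S J m in \<open>auto simp: zero_power\<close>)
      also have "\<dots> = (\<Sum>j\<in>J. a j * x j ^ m j)" using J by (intro sum.cong) auto
      finally show ?thesis .
    qed
    have "bij_betw (\<lambda>x. restrict x J) {x\<in>A. supp x = J} ?B"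
    proof (rule bij_betwI[where g = ?ext])
      show "(\<lambda>x. restrict x J) \<in> {x \<in> A. supp x = J} \<rightarrow> ?B"
        using sum1 by (fastforce simp: A_def supp_def)
      show "?ext \<in> ?B \<rightarrow> {x \<in> A. supp x = J}"
        using sum2 J by (fastforce simp: A_def supp_def PiE_def Pi_def)
      show "?ext (restrict x J) = x" if "x \<in> {x \<in> A. supp x = J}" for x
        using that by (intro extensionalityI[of _ S]) (auto simp: A_def supp_def PiE_def)
      show "restrict (?ext x) J = x" if "x \<in> ?B" for x
        using that J by (intro extensionalityI[of _ J]) (auto simp: PiE_def)
    qed
    then show "(\<Sum>x\<in>{x\<in>A. supp x = J}. 1) = card ?B" by (simp add: bij_betw_same_card)
  qed
  finally show ?thesis by (simp add: A_def)
qed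

section \<open>Equidistribution among the powers\<close>

lemma Gcd_image_bezout:
  fixes g :: "'i \<Rightarrow> int"
  assumes "finite S"
  shows "\<exists>v. Gcd (g ` S) = (\<Sum>j\<in>S. v j * g j)"
  using assms
proof (induction S rule: finite_induct)
  case (insert i S)
  then obtain v where v: "Gcd (g ` S) = (\<Sum>j\<in>S. v j * g j)" by blast
  obtain r s where rs: "r * g i + s * Gcd (g ` S) = gcd (g i) (Gcd (g ` S))"
    using bezout_int by blast
  define v' where "v' = (\<lambda>j. if j = i then r else s * v j)"
  have "(\<Sum>j\<in>S. v' j * g j) = (\<Sum>j\<in>S. s * (v j * g j))"
    by (rule sum.cong) (use insert in \<open>auto simp: v'_def\<close>)
  then have "(\<Sum>j\<in>insert i S. v' j * g j) = Gcd (g ` insert i S)"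
    using insert rs v by (simp add: v'_def sum_distrib_left)
  then show ?case by metis
qed auto

lemma prod_powi:
  fixes w :: "'a::field"
  assumes "w \<noteq> 0"
  shows "(\<Prod>j\<in>S. w powi g j) = w powi (\<Sum>j\<in>S. g j)"
  by (induction S rule: infinite_finite_induct) (use assms in \<open>auto simp: power_int_add\<close>)

text \<open>\<open>comb\<close> is the gcd condition in Bezout form with the denominator
  \<open>k0\<close> cleared. Its coefficients give a scaling that multiplies \<open>h\<close> by
  \<open>w ^ k0\<close>, so \<open>h\<close> is equidistributed on the group \<open>K\<close> of
  nonzero \<open>k0\<close>-th powers, and solutions are the points with
  \<open>h x = 1\<close>.\<close>

lemma card_nonzero_solutions:
  fixes a :: "'i \<Rightarrow> 'a::{field,finite}" and m kk :: "'i \<Rightarrow> nat" and u y :: int and v :: "'i \<Rightarrow> int"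
    and S :: "'i set"
  defines "q \<equiv> card (UNIV :: 'a set)" and "X \<equiv> PiE S (\<lambda>_. UNIV - {0 :: 'a})"
  assumes S: "finite S" and b: "b = c ^ k0" "b \<noteq> 0" and k: "k > 0"
    and M: "\<And>j. j \<in> S \<Longrightarrow> m j dvd M"
    and dvd: "k0 dvd k" "\<And>j. j \<in> S \<Longrightarrow> k0 dvd kk j" "k0 dvd q - 1"
    and comb: "int k0 = u * ((\<Sum>j\<in>S. int (kk j * (M div m j))) - int (k * M)) + y * int (q - 1)
        + (\<Sum>j\<in>S. v j * int (kk j * ((q - 1) div gcd (m j) (q - 1))))"
  shows "card {x \<in> X. (\<Sum>j\<in>S. a j * x j ^ m j) ^ k = b * (\<Prod>j\<in>S. x j ^ kk j)} * (q - 1) =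
    k0 * card {x \<in> X. (\<Sum>j\<in>S. a j * x j ^ m j) \<noteq> 0}"
proof -
  define f where "f = (\<lambda>x. \<Sum>j\<in>S. a j * x j ^ m j)"
  define P where "P = {x \<in> X. f x \<noteq> 0}"
  define h where "h = (\<lambda>x. f x ^ k / (b * (\<Prod>j\<in>S. x j ^ kk j)))"
  define K where "K = (\<lambda>x :: 'a. x ^ k0) ` (UNIV - {0})"
  have finP: "finite P" unfolding P_def X_def using S
    by (intro finite_subset[OF _ finite_PiE[of S "\<lambda>_. UNIV - {0}"]]) auto
  have prod_nz: "(\<Prod>j\<in>S. x j ^ kk j) \<noteq> 0" if "x \<in> X" for x
    using that S by (auto simp: X_def)
  have scale: "\<exists>\<psi>. inj_on \<psi> P \<and> (\<forall>x\<in>P. \<psi> x \<in> P \<and> h (\<psi> x) = h x * w ^ k0)" if w: "w \<noteq> 0" for w :: 'a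
  proof -
    define d where "d = (\<lambda>j. (q - 1) div gcd (m j) (q - 1))"
    \<comment> \<open>The first part scales every term of \<open>f\<close> by the same power of
      \<open>w\<close>; in the second, \<open>w powi int (d j)\<close> is an \<open>m j\<close>-th
      root of unity, which changes only the product side.\<close>
    define ex where "ex = (\<lambda>j. - u * int (M div m j) - v j * int (d j))"
    define \<psi> where "\<psi> = (\<lambda>x. \<lambda>j\<in>S. x j * w powi ex j)"
    have wm: "(w powi ex j) ^ m j = w powi (- u * int M)" if j: "j \<in> S" for j
    proof -
      have "d j * m j = (q - 1) * (m j div gcd (m j) (q - 1))"
        unfolding d_def by (metis div_mult_swap dvd_div_mult gcd_dvd1 gcd_dvd2 mult.commute)
      then have 1: "int (d j) * int (m j) = int (q - 1) * int (m j div gcd (m j) (q - 1))"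
        by (metis of_nat_mult)
      have 2: "int (M div m j) * int (m j) = int M"
        using M[OF j] by (metis dvd_div_mult_self of_nat_mult)
      have "ex j * int (m j) = - u * (int (M div m j) * int (m j)) - v j * (int (d j) * int (m j))"
        by (simp add: ex_def algebra_simps)
      also have "\<dots> = - u * int M + int (q - 1) * (- v j * int (m j div gcd (m j) (q - 1)))"
        unfolding 1 2 by (simp only: algebra_simps)
      finally have "w powi (ex j * int (m j)) =
          w powi (- u * int M) * w powi (int (q - 1) * (- v j * int (m j div gcd (m j) (q - 1))))"
        using w by (simp only: power_int_add simp_thms)
      then have "w powi (ex j * int (m j)) = w powi (- u * int M)"
        by (simp only: powi_card_minus_1[OF w, folded q_def] mult_1_right)
      then show ?thesis by (simp only: power_int_power')
    qed
    have f: "f (\<psi> x) = w powi (- u * int M) * f x" for x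
      unfolding f_def sum_distrib_left
      by (rule sum.cong) (auto simp: \<psi>_def power_mult_distrib wm)
    have prod: "(\<Prod>j\<in>S. \<psi> x j ^ kk j) = w powi (\<Sum>j\<in>S. ex j * int (kk j)) * (\<Prod>j\<in>S. x j ^ kk j)" for x
    proof -
      have "(\<Prod>j\<in>S. \<psi> x j ^ kk j) = (\<Prod>j\<in>S. w powi (ex j * int (kk j)) * x j ^ kk j)"
        by (rule prod.cong) (auto simp: \<psi>_def power_mult_distrib power_int_power')
      then show ?thesis by (simp add: prod.distrib prod_powi[OF w])
    qed
    have "(\<Sum>j\<in>S. ex j * int (kk j)) =
        - u * (\<Sum>j\<in>S. int (kk j * (M div m j))) - (\<Sum>j\<in>S. v j * int (kk j * d j))"
      unfolding sum_distrib_left sum_subtractf[symmetric]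
      by (rule sum.cong) (auto simp: ex_def algebra_simps)
    \<comment> \<open>This compares the exponents of \<open>w\<close> on the two sides of the
      equation: by \<open>comb\<close> they differ by \<open>k0\<close> up to a multiple of
      \<open>q - 1\<close>.\<close>
    then have "- u * int M * int k = (\<Sum>j\<in>S. ex j * int (kk j)) + int k0 + int (q - 1) * (- y)"
      using comb by (simp add: d_def algebra_simps)
    then have "(w powi (- u * int M)) ^ k = w powi (\<Sum>j\<in>S. ex j * int (kk j)) * w ^ k0"
      using w by (simp only: power_int_power' power_int_add simp_thms
          powi_card_minus_1[OF w, folded q_def] mult_1_right power_int_of_nat)
    then have hh: "h (\<psi> x) = h x * w ^ k0" for x
      using w by (simp add: h_def f prod power_mult_distrib)
    have "\<psi> x \<in> P" if "x \<in> P" for x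
      using that w f[of x] by (auto simp: P_def X_def \<psi>_def)
    moreover have "inj_on \<psi> P"
    proof (rule inj_onI)
      fix r r' assume r: "r \<in> P" "r' \<in> P" "\<psi> r = \<psi> r'"
      have "r j = r' j" if "j \<in> S" for j
        using fun_cong[OF r(3), of j] w that by (simp add: \<psi>_def)
      then show "r = r'" using r by (intro PiE_ext[of _ S]) (auto simp: P_def X_def)
    qed
    ultimately show ?thesis using hh by blast
  qed
  have hK: "h x \<in> K" if x: "x \<in> P" for x
  proof -
    \<comment> \<open>Since \<open>b\<close> is a \<open>k0\<close>-th power and \<open>k0\<close>
      divides all exponents, \<open>h\<close> takes values in \<open>K\<close>.\<close>
    have "h x = (f x ^ (k div k0) / (c * (\<Prod>j\<in>S. x j ^ (kk j div k0)))) ^ k0"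
    proof -
      have "(\<Prod>j\<in>S. x j ^ (kk j div k0)) ^ k0 = (\<Prod>j\<in>S. x j ^ kk j)"
        unfolding prod_power_distrib
        by (rule prod.cong) (auto simp: dvd simp flip: power_mult)
      then show ?thesis using dvd(1)
        by (simp add: h_def b power_divide power_mult_distrib flip: power_mult)
    qed
    moreover have "c \<noteq> 0" if "k0 > 0" using that b by auto
    moreover have "k0 > 0" using dvd(1) k by (auto intro!: Nat.gr0I)
    ultimately show ?thesis using x prod_nz[of x] S
      by (auto simp: K_def P_def X_def intro!: image_eqI)
  qed
  have trans: "\<exists>w. w \<noteq> 0 \<and> z' = z * w ^ k0" if zK: "z \<in> K" "z' \<in> K" for z z'
  proof -
    obtain s s' where "s \<noteq> 0" "s' \<noteq> 0" "z = s ^ k0" "z' = s' ^ k0" using zK by (auto simp: K_def)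
    then show ?thesis by (intro exI[of _ "s' / s"]) (auto simp: power_divide)
  qed
  have "card {x \<in> P. h x \<in> {1}} * card (h ` P) = card P * card ({1} \<inter> h ` P)"
  proof (rule card_fibers_action[OF finP])
    fix p p' assume p: "p \<in> P" "p' \<in> P"
    obtain w where "w \<noteq> 0" "h p' = h p * w ^ k0" using trans hK p by blast
    then show "\<exists>\<psi>. inj_on \<psi> P \<and> (\<forall>r\<in>P. \<psi> r \<in> P \<and> (h r = h p \<longrightarrow> h (\<psi> r) = h p'))"
      using scale[of w] by auto
  qed
  moreover have "h ` P = K" if ne: "P \<noteq> {}"
  proof
    show "K \<subseteq> h ` P"
    proof
      fix z assume z: "z \<in> K"
      obtain p where p: "p \<in> P" using ne by blast
      obtain w where "w \<noteq> 0" "z = h p * w ^ k0" using trans hK p z by blast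
      then show "z \<in> h ` P" using scale[of w] p by force
    qed
  qed (use hK in auto)
  moreover have "1 \<in> K" by (auto simp: K_def intro!: image_eqI[of _ _ 1])
  ultimately have cardP: "card {x \<in> P. h x = 1} * card K = card P"
    by (cases "P = {}") auto
  have cardK: "k0 * card K = q - 1"
    using card_nonzero_powers(1)[of k0] dvd(3) unfolding K_def q_def by blast
  \<comment> \<open>On \<open>X\<close> the right-hand side is nonzero, so a solution there
    automatically has \<open>f x\<close> nonzero.\<close>
  have "{x \<in> X. f x ^ k = b * (\<Prod>j\<in>S. x j ^ kk j)} = {x \<in> P. h x = 1}"
    using prod_nz b(2) k by (auto simp: P_def h_def divide_eq_1_iff zero_power)
  then have "card {x \<in> X. f x ^ k = b * (\<Prod>j\<in>S. x j ^ kk j)} * (q - 1) =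
      k0 * (card {x \<in> P. h x = 1} * card K)"
    unfolding cardK[symmetric] by (simp only: mult_ac)
  then show ?thesis unfolding cardP unfolding P_def f_def .
qed

section \<open>Evaluation of the weight sums\<close>

text \<open>This is the case of variables ranging over the whole field: the factor over
  \<open>S - T\<close> vanishes unless \<open>T = S\<close>.\<close>

lemma weight_sum_zero:
  assumes "finite S"
  shows "weight_sum (\<lambda>_. 0) \<gamma> e S p =
    (if even (card S) = p then (\<Prod>i\<in>S. \<gamma> i) * e ^ (card S div 2) else 0)"
proof -
  let ?w = "\<lambda>T. (\<Prod>i\<in>T. \<gamma> i) * (\<Prod>i\<in>S-T. - 0 :: real) * e ^ (card T div 2)"
  have "weight_sum (\<lambda>_. 0) \<gamma> e S p = (\<Sum>T\<in>{S} \<inter> {T. even (card T) = p}. ?w T)"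
    unfolding weight_sum_def
  proof (rule sum.mono_neutral_right)
    show "\<forall>T\<in>{T. T \<subseteq> S \<and> even (card T) = p} - {S} \<inter> {T. even (card T) = p}. ?w T = 0"
    proof
      fix T assume "T \<in> {T. T \<subseteq> S \<and> even (card T) = p} - {S} \<inter> {T. even (card T) = p}"
      then have "T \<subseteq> S" "T \<noteq> S" by auto
      then obtain i where "i \<in> S - T" by blast
      then have "(\<Prod>i\<in>S-T. - 0 :: real) = 0" using assms by (intro prod_zero) auto
      then show "?w T = 0" by simp
    qed
  qed (use assms in auto)
  then show ?thesis by auto
qed

text \<open>This is the torus case. Only even subsets of \<open>R\<close> survive, their signs all
  equal \<open>(-1) ^ card S\<close>, and grouping them by half their size produces elementary
  symmetric polynomials.\<close>

lemma weight_sum_one: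
  fixes S R :: "nat set"
  assumes S: "finite S" and R: "R \<subseteq> S"
  shows "weight_sum (\<lambda>_. 1) (\<lambda>i. if i \<in> R then g i else 0) e S True =
    (-1) ^ card S * (\<Sum>j=0..card R div 2. esym R g (2 * j) * e ^ j)"
proof -
  let ?\<gamma> = "\<lambda>i. if i \<in> R then g i else 0"
  let ?A = "{T. T \<subseteq> R \<and> even (card T)}"
  have finR: "finite R" using S R finite_subset by blast
  have "weight_sum (\<lambda>_. 1) ?\<gamma> e S True =
      (\<Sum>T\<in>?A. (\<Prod>i\<in>T. ?\<gamma> i) * (\<Prod>i\<in>S-T. - 1) * e ^ (card T div 2))"
    unfolding weight_sum_def
  proof (rule sum.mono_neutral_right)
    show "\<forall>T\<in>{T. T \<subseteq> S \<and> even (card T) = True} - ?A.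
        (\<Prod>i\<in>T. ?\<gamma> i) * (\<Prod>i\<in>S-T. - 1) * e ^ (card T div 2) = 0"
    proof
      fix T assume T: "T \<in> {T. T \<subseteq> S \<and> even (card T) = True} - ?A"
      then obtain i where "i \<in> T" "i \<notin> R" by auto
      moreover have "finite T" using T S finite_subset by blast
      ultimately have "(\<Prod>i\<in>T. ?\<gamma> i) = 0" by (intro prod_zero) auto
      then show "(\<Prod>i\<in>T. ?\<gamma> i) * (\<Prod>i\<in>S-T. - 1) * e ^ (card T div 2) = 0" by simp
    qed
  qed (use S R in auto)
  also have "\<dots> = (\<Sum>T\<in>?A. (-1) ^ card S * ((\<Prod>i\<in>T. g i) * e ^ (card T div 2)))"
  proof (rule sum.cong[OF refl])
    fix T assume T: "T \<in> ?A"
    then have TS: "T \<subseteq> S" "finite T" using R finR finite_subset by auto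
    have "(\<Prod>i\<in>T. ?\<gamma> i) = (\<Prod>i\<in>T. g i)" by (rule prod.cong) (use T in auto)
    moreover have "card S = card (S - T) + card T"
      using TS S card_mono[OF S TS(1)] by (simp add: card_Diff_subset)
    then have "(-1 :: real) ^ card (S - T) = (-1) ^ card S" using T by (simp add: power_add)
    ultimately show "(\<Prod>i\<in>T. ?\<gamma> i) * (\<Prod>i\<in>S-T. - 1) * e ^ (card T div 2) =
        (-1) ^ card S * ((\<Prod>i\<in>T. g i) * e ^ (card T div 2))" by simp
  qed
  also have "\<dots> = (-1) ^ card S * (\<Sum>T\<in>?A. (\<Prod>i\<in>T. g i) * e ^ (card T div 2))"
    by (simp add: sum_distrib_left)
  also have "(\<Sum>T\<in>?A. (\<Prod>i\<in>T. g i) * e ^ (card T div 2)) =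
      (\<Sum>j=0..card R div 2. \<Sum>T\<in>{T\<in>?A. card T div 2 = j}. (\<Prod>i\<in>T. g i) * e ^ (card T div 2))"
    by (rule sum.group[symmetric]) (use finR in \<open>auto intro!: div_le_mono card_mono\<close>)
  also have "\<dots> = (\<Sum>j=0..card R div 2. esym R g (2 * j) * e ^ j)"
  proof (rule sum.cong[OF refl])
    fix j
    have "{T\<in>?A. card T div 2 = j} = {T. T \<subseteq> R \<and> card T = 2 * j}" by auto
    then show "(\<Sum>T\<in>{T\<in>?A. card T div 2 = j}. (\<Prod>i\<in>T. g i) * e ^ (card T div 2)) =
        esym R g (2 * j) * e ^ j"
      by (simp add: esym_def sum_distrib_right)
  qed
  finally show ?thesis .
qed

text \<open>Exponents are first replaced by \<open>1\<close> or \<open>2\<close> according to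
  parity; then \<open>card_additive_solutions\<close> is evaluated at \<open>c = 0\<close>, where
  the \<open>\<chi>\<close> term drops out. \<open>B\<close> selects the torus or the full
  space.\<close>

lemma card_diagonal_solutions:
  fixes a :: "'i \<Rightarrow> 'a::{field,finite}" and m :: "'i \<Rightarrow> nat" and T :: "'i set"
  defines "q \<equiv> card (UNIV :: 'a set)"
  defines "d \<equiv> (\<lambda>j. gcd (m j) (q - 1))"
  assumes S: "finite S" and a: "\<And>j. j \<in> S \<Longrightarrow> a j \<noteq> 0" and m: "\<And>j. j \<in> S \<Longrightarrow> m j > 0"
    and odd: "\<And>j. j \<in> S \<Longrightarrow> j \<in> T \<Longrightarrow> odd (d j)" and even: "\<And>j. j \<in> S \<Longrightarrow> j \<notin> T \<Longrightarrow> even (d j)"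
    and coprime: "\<And>i j. i \<in> S \<Longrightarrow> j \<in> S \<Longrightarrow> i \<noteq> j \<Longrightarrow>
      coprime (if i \<in> T then d i else d i div 2) (if j \<in> T then d j else d j div 2)"
  shows "real q * real (card {x \<in> PiE S (\<lambda>_. UNIV - (if B then {0} else {})). (\<Sum>j\<in>S. a j * x j ^ m j) = 0}) =
    (real q - of_bool B) ^ card S + (real q - 1) *
      weight_sum (\<lambda>_. of_bool B) (\<lambda>j. if j \<in> S - T then eta (a j) else 0) (eta (-1 :: 'a) * real q) S True"
proof -
  define m' :: "'i \<Rightarrow> nat" where "m' = (\<lambda>j. if j \<in> T then 1 else 2)"
  have image: "torus_image J m = (torus_image J m' :: ('i \<Rightarrow> 'a) set)" if J: "J \<subseteq> S" for J
    unfolding m'_def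
    by (rule torus_image_parity;
        use finite_subset[OF J S] odd even coprime subsetD[OF J] in \<open>unfold d_def q_def, blast\<close>)
  have torus: "card {x \<in> PiE J (\<lambda>_. UNIV - {0}). (\<Sum>j\<in>J. a j * x j ^ m j) = 0} =
      card {x \<in> PiE J (\<lambda>_. UNIV - {0}). (\<Sum>j\<in>J. a j * x j ^ m' j) = 0}" if J: "J \<subseteq> S" for J
    by (rule card_torus_solutions_cong[OF finite_subset[OF J S] image[OF J]])
  have "card {x \<in> PiE S (\<lambda>_. UNIV). (\<Sum>j\<in>S. a j * x j ^ m j) = 0} =
      card {x \<in> PiE S (\<lambda>_. UNIV). (\<Sum>j\<in>S. a j * x j ^ m' j) = 0}"
    using S m torus by (simp add: card_solutions_by_support m'_def)
  then have eq: "card {x \<in> PiE S (\<lambda>_. UNIV - (if B then {0} else {})). (\<Sum>j\<in>S. a j * x j ^ m j) = 0} =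
      card {x \<in> PiE S (\<lambda>_. UNIV - (if B then {0} else {})). (\<Sum>j\<in>S. a j * x j ^ m' j) = 0}"
    using torus[OF order.refl] by simp
  define \<gamma> where "\<gamma> = (\<lambda>j. if j \<in> S - T then eta (a j) else 0)"
  define \<chi> :: "'a \<Rightarrow> real" where "\<chi> = (if odd q then eta else (\<lambda>_. 0))"
  define \<epsilon> :: real where "\<epsilon> = (if odd q then eta (-1 :: 'a) else 0)"
  have odd_q: "odd q" if "j \<in> S" "j \<notin> T" for j
    using even[OF that] card_field_gt_1[where 'a = 'a] by (auto simp: d_def q_def)
  have "real q * real (card {x \<in> PiE S (\<lambda>_. UNIV - (if B then {0} else {})). (\<Sum>j\<in>S. a j * x j ^ m' j) = 0}) =
      (\<Prod>i\<in>S. real q - of_bool B) + weight_sum (\<lambda>_. of_bool B) \<gamma> (\<epsilon> * real q) S True * (real q * of_bool ((0 :: 'a) = 0) - 1)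
      + real q * weight_sum (\<lambda>_. of_bool B) \<gamma> (\<epsilon> * real q) S False * \<chi> 0"
    unfolding q_def
  proof (rule card_additive_solutions[OF S])
    fix i z assume i: "i \<in> S"
    show "real (card {x \<in> UNIV - (if B then {0} else {}). a i * x ^ m' i = z}) =
        1 - of_bool B * of_bool (z = 0) + \<gamma> i * \<chi> z"
      using i a[OF i] card_linear_fiber[of "a i" B z] card_quadratic_fiber[of "a i" B z] odd_q[OF i]
      by (auto simp: m'_def \<gamma>_def \<chi>_def q_def)
  next
    show "(\<Sum>z\<in>UNIV. \<chi> z) = 0" by (auto simp: \<chi>_def q_def sum_eta)
    show "(\<Sum>y\<in>UNIV. \<chi> y * \<chi> (c - y)) = \<epsilon> * (real (card (UNIV :: 'a set)) * of_bool (c = 0) - 1)" for c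
      by (auto simp: \<chi>_def \<epsilon>_def q_def eta_convolution)
  qed (auto simp: \<chi>_def)
  \<comment> \<open>The default \<open>\<epsilon> = 0\<close> for even \<open>q\<close> is
    invisible: there \<open>\<gamma>\<close> vanishes, so only the empty subset contributes, with
    exponent \<open>0\<close>.\<close>
  also have "weight_sum (\<lambda>_. of_bool B) \<gamma> (\<epsilon> * real q) S True =
      weight_sum (\<lambda>_. of_bool B) \<gamma> (eta (-1 :: 'a) * real q) S True"
  proof (cases "odd q")
    case False
    then have "S - T = {}" using odd_q by blast
    then have \<gamma>: "\<gamma> = (\<lambda>_. 0)" by (auto simp: \<gamma>_def fun_eq_iff)
    show ?thesis unfolding weight_sum_def \<gamma>
    proof (rule sum.cong[OF refl])
      fix U assume "U \<in> {U. U \<subseteq> S \<and> even (card U) = True}"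
      then have "finite U" using S finite_subset by blast
      then show "(\<Prod>i\<in>U. 0) * (\<Prod>i\<in>S - U. - of_bool B) * (\<epsilon> * real q) ^ (card U div 2) =
          (\<Prod>i\<in>U. 0) * (\<Prod>i\<in>S - U. - of_bool B) * (eta (-1 :: 'a) * real q) ^ (card U div 2)"
        by (cases "U = {}") auto
    qed
  qed (simp add: \<epsilon>_def)
  finally show ?thesis unfolding eq \<gamma>_def by (simp add: \<chi>_def mult.commute)
qed

section \<open>From zero counts of the diagonal form to the three formulas\<close>

text \<open>If some coordinate is zero, the right-hand product vanishes and the equation reduces to
  \<open>f x = 0\<close>. The additive form avoids subtraction of natural numbers.\<close>

lemma Nsol_eq:
  fixes a :: "nat \<Rightarrow> 'a::{field,finite}" and m :: "nat \<Rightarrow> nat"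
  assumes k: "k > 0" and kk: "\<And>j. j \<in> {1..n} \<Longrightarrow> kk j > 0"
  defines "f \<equiv> \<lambda>x. \<Sum>j=1..n. a j * x j ^ m j" and "X \<equiv> PiE {1..n} (\<lambda>_. UNIV - {0 :: 'a})"
  shows "Nsol n a b k kk m + card {x \<in> X. f x = 0} =
    card {x \<in> X. f x ^ k = b * (\<Prod>j=1..n. x j ^ kk j)} + card {x \<in> PiE {1..n} (\<lambda>_. UNIV). f x = 0}"
proof -
  define Y where "Y = PiE {1..n} (\<lambda>_. UNIV :: 'a set)"
  define A where "A = {x \<in> X. f x ^ k = b * (\<Prod>j=1..n. x j ^ kk j)}"
  have fin: "finite Y" unfolding Y_def by (intro finite_PiE) auto
  have XY: "X \<subseteq> Y" unfolding X_def Y_def by (intro PiE_mono) auto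
  have "(f x ^ k = b * (\<Prod>j=1..n. x j ^ kk j)) = (f x = 0)" if x: "x \<in> Y - X" for x
  proof -
    obtain i where "i \<in> {1..n}" "x i = 0" using x by (auto simp: X_def Y_def PiE_iff)
    then have "(\<Prod>j=1..n. x j ^ kk j) = 0"
      using kk[of i] by (intro prod_zero) (auto simp: zero_power intro!: bexI[of _ i])
    then show ?thesis using k by (simp only: mult_zero_right power_eq_0_iff simp_thms)
  qed
  then have "{x \<in> Y. f x ^ k = b * (\<Prod>j=1..n. x j ^ kk j)} = A \<union> {x \<in> Y - X. f x = 0}"
    using XY by (auto simp: A_def)
  then have "Nsol n a b k kk m = card (A \<union> {x \<in> Y - X. f x = 0})"
    unfolding Nsol_def f_def Y_def by simp
  also have "\<dots> = card A + card {x \<in> Y - X. f x = 0}"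
    by (rule card_Un_disjoint) (use fin finite_subset[OF XY fin] in \<open>auto simp: A_def\<close>)
  finally have 1: "Nsol n a b k kk m = card A + card {x \<in> Y - X. f x = 0}" .
  have "{x \<in> Y. f x = 0} = {x \<in> X. f x = 0} \<union> {x \<in> Y - X. f x = 0}" using XY by auto
  also have "card \<dots> = card {x \<in> X. f x = 0} + card {x \<in> Y - X. f x = 0}"
    by (rule card_Un_disjoint) (use fin finite_subset[OF XY fin] in auto)
  finally show ?thesis using 1 by (simp add: A_def Y_def)
qed

theorem theorem3:
  fixes a :: "nat \<Rightarrow> 'a::{field,finite}" and b :: 'a
    and n k t :: nat and kk m :: "nat \<Rightarrow> nat"
  defines "q \<equiv> card (UNIV :: 'a set)"
  defines "d \<equiv> (\<lambda>j. gcd (m j) (q - 1))"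
  defines "M \<equiv> Lcm (m ` {1..n})"
  defines "k0 \<equiv> Gcd ({k, q - 1} \<union> kk ` {1..n})"
  assumes n2: "n \<ge> 2"
    and a_nz: "\<forall>j\<in>{1..n}. a j \<noteq> 0"
    and b_nz: "b \<noteq> 0"
    and k_pos: "k > 0"
    and kk_pos: "\<forall>j\<in>{1..n}. kk j > 0"
    and m_pos: "\<forall>j\<in>{1..n}. m j > 0"
    and t_le: "t \<le> n"
    and d_odd: "\<forall>j\<in>{1..t}. odd (d j)"
    and d_even: "\<forall>j\<in>{t+1..n}. even (d j)"
    and d_coprime: "\<forall>i\<in>{1..n}. \<forall>j\<in>{1..n}. i \<noteq> j \<longrightarrow>
        coprime (if i \<le> t then d i else d i div 2) (if j \<le> t then d j else d j div 2)"
    and b_pow: "\<exists>y. b = y ^ k0"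
    and gcd1: "Gcd ({(\<Sum>j=1..n. int (kk j * M div (k0 * m j))) - int (k * M div k0),
                     int ((q - 1) div k0)}
                    \<union> (\<lambda>j. int (kk j * (q - 1) div (k0 * d j))) ` {1..n}) = 1"
  shows
   "(t = 0 \<and> even n \<longrightarrow>
      real (Nsol n a b k kk m) =
        real q ^ (n - 1) - 1 + (real k0 - 1) * ((real q - 1) ^ n - 1) / real q
        - real k0 * eta ((-1) ^ (n div 2) * (\<Prod>j=1..n. a j)) * real q ^ ((n - 2) div 2)
        - (real k0 + real q - 1) *
          (\<Sum>j=1..(n - 2) div 2. eta ((-1) ^ j :: 'a) * esym {1..n} (\<lambda>i. eta (a i)) (2 * j)
                                   * real q ^ (j - 1)))
    \<and> (t = n \<longrightarrow>
      real (Nsol n a b k kk m) =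
        real q ^ (n - 1) - (-1) ^ n + (real k0 - 1) * ((real q - 1) ^ n - (-1) ^ n) / real q)
    \<and> (\<not> (t = 0 \<and> even n) \<and> t \<noteq> n \<longrightarrow>
      real (Nsol n a b k kk m) =
        real q ^ (n - 1) - (-1) ^ n + (real k0 - 1) * ((real q - 1) ^ n - (-1) ^ n) / real q
        - (-1) ^ n * (real k0 + real q - 1) *
          (\<Sum>j=1..(n - t) div 2. eta ((-1) ^ j :: 'a) * esym {t+1..n} (\<lambda>i. eta (a i)) (2 * j)
                                   * real q ^ (j - 1)))"
proof -
  define X where "X = PiE {1..n} (\<lambda>_. UNIV - {0 :: 'a})"
  define f where "f = (\<lambda>x. \<Sum>j=1..n. a j * x j ^ m j)"
  define N where "N = real (Nsol n a b k kk m)"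
  define W where "W = (\<lambda>B. weight_sum (\<lambda>_. of_bool B) (\<lambda>j. if j \<in> {t+1..n} then eta (a j) else 0)
      (eta (-1 :: 'a) * real q) {1..n} True)"
  have q1: "q > 1" unfolding q_def by (rule card_field_gt_1)
  have dvd: "k0 dvd k" "k0 dvd q - 1"
    unfolding k0_def by (rule Gcd_dvd, blast)+
  have dvd_kk: "k0 dvd kk j" if "j \<in> {1..n}" for j
    unfolding k0_def by (rule Gcd_dvd) (use that in blast)
  have k0: "k0 > 0" using dvd(1) k_pos by (auto intro!: Nat.gr0I)
  have dvdM: "m j dvd M" if "j \<in> {1..n}" for j
    unfolding M_def using that by (intro dvd_Lcm) auto

  \<comment> \<open>The quotients in \<open>gcd1\<close> use \<open>div\<close>; this shows that
    they are exact once multiplied by \<open>k0\<close>.\<close>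
  have exact: "kk j * c div (k0 * e) * k0 = kk j * (c div e)" if j: "j \<in> {1..n}" and e: "e dvd c" for j c e
  proof -
    obtain r s where "kk j = k0 * r" "c = e * s" using dvd_kk[OF j] e by (auto simp: dvd_def)
    then show ?thesis using k0 by (cases "e = 0") (simp_all add: mult.assoc mult.left_commute)
  qed
  define x y z where "x = (\<Sum>j=1..n. int (kk j * M div (k0 * m j))) - int (k * M div k0)"
    and "y = int ((q - 1) div k0)" and "z = (\<lambda>j. int (kk j * (q - 1) div (k0 * d j)))"
  obtain v where v: "Gcd (z ` {1..n}) = (\<Sum>j=1..n. v j * z j)"
    using Gcd_image_bezout[of "{1..n}" z] by auto
  obtain r s where rs: "r * y + s * Gcd (z ` {1..n}) = gcd y (Gcd (z ` {1..n}))"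
    using bezout_int by blast
  obtain u w where uw: "u * x + w * gcd y (Gcd (z ` {1..n})) = gcd x (gcd y (Gcd (z ` {1..n})))"
    using bezout_int by blast
  have "gcd x (gcd y (Gcd (z ` {1..n}))) = 1"
    using gcd1 by (simp add: x_def y_def z_def Gcd_insert)
  then have "1 = u * x + w * (r * y + s * Gcd (z ` {1..n}))"
    unfolding rs uw ..
  then have "1 = u * x + w * r * y + (\<Sum>j=1..n. w * s * v j * z j)"
    unfolding v by (simp add: algebra_simps sum_distrib_left)
  \<comment> \<open>Multiplying the Bezout relation by \<open>k0\<close> clears the denominators and
    yields the premise \<open>comb\<close> of \<open>card_nonzero_solutions\<close>.\<close>
  then have "int k0 * 1 = int k0 * (u * x + w * r * y + (\<Sum>j=1..n. w * s * v j * z j))" by simp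
  also have "\<dots> = u * (x * int k0) + w * r * (y * int k0) + (\<Sum>j=1..n. w * s * v j * (z j * int k0))"
    by (simp add: algebra_simps sum_distrib_left)
  also have "x * int k0 = (\<Sum>j=1..n. int (kk j * (M div m j))) - int (k * M)"
  proof -
    have "k * M div k0 * k0 = k * M" using dvd(1) by simp
    then have "int (k * M div k0) * int k0 = int (k * M)" by (metis of_nat_mult)
    moreover have "(\<Sum>j=1..n. int (kk j * M div (k0 * m j)) * int k0) = (\<Sum>j=1..n. int (kk j * (M div m j)))"
      by (rule sum.cong) (use exact dvdM in \<open>auto simp flip: of_nat_mult\<close>)
    ultimately show ?thesis by (simp add: x_def left_diff_distrib sum_distrib_right)
  qed
  also have "y * int k0 = int (q - 1)"
    using dvd(2) by (simp add: y_def flip: of_nat_mult)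
  also have "(\<Sum>j=1..n. w * s * v j * (z j * int k0)) =
      (\<Sum>j=1..n. w * s * v j * int (kk j * ((q - 1) div gcd (m j) (q - 1))))"
    by (rule sum.cong) (use exact in \<open>auto simp: z_def d_def simp flip: of_nat_mult\<close>)
  finally have comb: "int k0 = u * ((\<Sum>j=1..n. int (kk j * (M div m j))) - int (k * M)) + w * r * int (q - 1)
        + (\<Sum>j=1..n. w * s * v j * int (kk j * ((q - 1) div gcd (m j) (q - 1))))" by simp

  obtain c where c: "b = c ^ k0" using b_pow by blast
  have torus: "card {x \<in> X. f x ^ k = b * (\<Prod>j=1..n. x j ^ kk j)} * (q - 1) = k0 * card {x \<in> X. f x \<noteq> 0}"
    unfolding X_def f_def q_def
    by (rule card_nonzero_solutions[OF _ c b_nz k_pos dvdM _ _ _ comb[unfolded q_def]])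
       (use dvd dvd_kk in \<open>auto simp: q_def\<close>)
  have cardX: "card {x \<in> X. f x \<noteq> 0} + card {x \<in> X. f x = 0} = (q - 1) ^ n"
  proof -
    have fin: "finite X" unfolding X_def by (intro finite_PiE) auto
    have "card {x \<in> X. f x \<noteq> 0} + card {x \<in> X. f x = 0} = card ({x \<in> X. f x \<noteq> 0} \<union> {x \<in> X. f x = 0})"
      by (rule card_Un_disjoint[symmetric]) (use fin in auto)
    also have "{x \<in> X. f x \<noteq> 0} \<union> {x \<in> X. f x = 0} = X" by auto
    finally show ?thesis by (simp add: X_def card_PiE q_def)
  qed
  have diag: "real q * real (card {x \<in> PiE {1..n} (\<lambda>_. UNIV - (if B then {0} else {})). f x = 0}) =
      (real q - of_bool B) ^ n + (real q - 1) * W B" for B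
  proof -
    have S: "{1..n} - {..t} = {t+1..n}" by auto
    have odd: "odd (gcd (m j) (q - 1))" if "j \<in> {1..n}" "j \<in> {..t}" for j
      using d_odd that unfolding d_def by auto
    have even: "even (gcd (m j) (q - 1))" if "j \<in> {1..n}" "j \<notin> {..t}" for j
      using d_even that unfolding d_def by auto
    have coprime: "coprime (if i \<in> {..t} then gcd (m i) (q - 1) else gcd (m i) (q - 1) div 2)
        (if j \<in> {..t} then gcd (m j) (q - 1) else gcd (m j) (q - 1) div 2)"
      if "i \<in> {1..n}" "j \<in> {1..n}" "i \<noteq> j" for i j
      using d_coprime that unfolding atMost_iff d_def by blast
    show ?thesis
      using card_diagonal_solutions[of "{1..n}" a m "{..t}" B, folded q_def,
          OF _ a_nz[rule_format] m_pos[rule_format] odd even coprime]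
      unfolding S W_def f_def card_atLeastAtMost diff_Suc_1 by (simp only: finite_atLeastAtMost) simp
  qed
  \<comment> \<open>Everything is now expressed by the torus weight \<open>W True\<close> and the
    full-space weight \<open>W False\<close>; the three cases differ only in their values.\<close>
  have main: "real q * N = real k0 * ((real q - 1) ^ n - W True) + real q ^ n - (real q - 1) ^ n
      + (real q - 1) * (W False - W True)"
  proof -
    define A B C D where "A = real (card {x \<in> X. f x ^ k = b * (\<Prod>j=1..n. x j ^ kk j)})"
      and "B = real (card {x \<in> X. f x = 0})" and "C = real (card {x \<in> X. f x \<noteq> 0})"
      and "D = real (card {x \<in> PiE {1..n} (\<lambda>_. UNIV). f x = 0})"
    have rq: "real (q - 1) = real q - 1" using q1 by simp
    have NB: "N + B = A + D"
      using Nsol_eq[of k n kk a b m] k_pos kk_pos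
      unfolding N_def A_def B_def D_def X_def f_def by (simp flip: of_nat_add)
    have 1: "A * (real q - 1) = real k0 * C"
      using torus unfolding A_def C_def by (simp flip: rq of_nat_mult)
    have 2: "C = (real q - 1) ^ n - B"
      using cardX unfolding C_def B_def by (simp add: eq_diff_eq flip: rq of_nat_add of_nat_power)
    have B: "real q * B = (real q - 1) ^ n + (real q - 1) * W True"
      using diag[of True] by (simp add: B_def X_def)
    have D: "real q * D = real q ^ n + (real q - 1) * W False"
      using diag[of False] by (simp add: D_def)
    have "(real q - 1) * (real q * A) = real q * (A * (real q - 1))" by simp
    also have "\<dots> = real k0 * (real q * (real q - 1) ^ n - real q * B)"
      unfolding 1 2 by (simp add: algebra_simps)
    also have "\<dots> = (real q - 1) * (real k0 * ((real q - 1) ^ n - W True))"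
      unfolding B by (simp add: algebra_simps)
    finally have A: "real q * A = real k0 * ((real q - 1) ^ n - W True)" using q1 by simp
    have "N = A + D - B" using NB by simp
    then have "real q * N = real q * A + real q * D - real q * B"
      by (simp only: distrib_left right_diff_distrib)
    then show ?thesis unfolding A B D by (simp add: algebra_simps)
  qed

  define E where "E = (\<lambda>j. eta ((-1) ^ j :: 'a) * esym {t+1..n} (\<lambda>i. eta (a i)) (2 * j) * real q ^ (j - 1))"
  have eta_neg: "eta ((-1) ^ j :: 'a) = eta (-1 :: 'a) ^ j" if "odd q" for j
    using that eta_power by (auto simp: q_def)
  \<comment> \<open>The term \<open>j = 0\<close> gives the \<open>1\<close>, and one factor
    \<open>q\<close> is taken out of the others. For \<open>t = n\<close> the sum is empty, so
    \<open>q\<close> may be even.\<close>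
  have W1: "W True = (-1) ^ n * (1 + real q * (\<Sum>j=1..(n - t) div 2. E j))" if "odd q \<or> t = n"
  proof -
    have "W True = (-1) ^ n * (\<Sum>j=0..(n - t) div 2.
        esym {t+1..n} (\<lambda>i. eta (a i)) (2 * j) * (eta (-1 :: 'a) * real q) ^ j)"
      unfolding W_def using weight_sum_one[of "{1..n}" "{t+1..n}" "\<lambda>i. eta (a i)"] by simp
    also have "(\<Sum>j=0..(n - t) div 2. esym {t+1..n} (\<lambda>i. eta (a i)) (2 * j) * (eta (-1 :: 'a) * real q) ^ j) =
        1 + (\<Sum>j=1..(n - t) div 2. esym {t+1..n} (\<lambda>i. eta (a i)) (2 * j) * (eta (-1 :: 'a) * real q) ^ j)"
    proof -
      have "{T. T \<subseteq> {t+1..n} \<and> card T = 0} = {{}}" by (auto dest: finite_subset)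
      then have "esym {t+1..n} (\<lambda>i. eta (a i)) 0 = 1" unfolding esym_def by simp
      then show ?thesis by (simp add: sum.atLeast_Suc_atMost)
    qed
    also have "(\<Sum>j=1..(n - t) div 2. esym {t+1..n} (\<lambda>i. eta (a i)) (2 * j) * (eta (-1 :: 'a) * real q) ^ j) =
        real q * (\<Sum>j=1..(n - t) div 2. E j)"
      unfolding sum_distrib_left
    proof (rule sum.cong[OF refl])
      fix j assume j: "j \<in> {1..(n - t) div 2}"
      then have "odd q" using that by auto
      moreover have "real q ^ j = real q * real q ^ (j - 1)" using j by (cases j) auto
      ultimately show "esym {t+1..n} (\<lambda>i. eta (a i)) (2 * j) * (eta (-1 :: 'a) * real q) ^ j = real q * E j"
        by (simp add: E_def eta_neg power_mult_distrib)
    qed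
    finally show ?thesis .
  qed
  have W0: "W False = (if even n then (\<Prod>j=1..n. if j \<in> {t+1..n} then eta (a j) else 0)
      * (eta (-1 :: 'a) * real q) ^ (n div 2) else 0)"
    unfolding W_def by (simp add: weight_sum_zero)
  \<comment> \<open>The full product needs an even number of variables, all of them quadratic; for
    \<open>t > 0\<close> the factor at index \<open>1\<close> is zero.\<close>
  have W0': "W False = 0" if "\<not> (t = 0 \<and> even n)"
  proof (cases "even n")
    case True
    then have "1 \<in> {1..n}" "1 \<notin> {t+1..n}" using that n2 by auto
    then have "(\<Prod>j=1..n. if j \<in> {t+1..n} then eta (a j) else 0) = 0"
      by (intro prod_zero) (auto intro!: bexI[of _ 1])
    then show ?thesis unfolding W0 by simp
  qed (simp add: W0)
  have odd_q: "odd q" if "t \<noteq> n"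
    using d_even[rule_format, of n] that t_le q1 n2 by (auto simp: d_def)
  have q_pow: "real q ^ n = real q * real q ^ (n - 1)" using n2 by (cases n) auto

  have general: "N = real q ^ (n - 1) - (-1) ^ n + (real k0 - 1) * ((real q - 1) ^ n - (-1) ^ n) / real q
      - (-1) ^ n * (real k0 + real q - 1) * (\<Sum>j=1..(n - t) div 2. E j)" if "\<not> (t = 0 \<and> even n)"
  proof -
    have W: "W True = (-1) ^ n * (1 + real q * (\<Sum>j=1..(n - t) div 2. E j))" using W1 odd_q by blast
    have "real q * N = real k0 * ((real q - 1) ^ n - (-1) ^ n * (1 + real q * (\<Sum>j=1..(n - t) div 2. E j)))
        + real q * real q ^ (n - 1) - (real q - 1) ^ n
        - (real q - 1) * ((-1) ^ n * (1 + real q * (\<Sum>j=1..(n - t) div 2. E j)))"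
      using main unfolding W W0'[OF that] q_pow by simp
    then show ?thesis using q1 by (simp add: field_simps)
  qed
  show ?thesis
  proof (intro conjI impI)
    assume t: "t = 0 \<and> even n"
    then have "t \<noteq> n" and oq: "odd q" using n2 odd_q by auto
    \<comment> \<open>The top term \<open>j = n div 2\<close> is split off as \<open>H\<close>: its
      symmetric polynomial is the full product of the \<open>eta (a j)\<close>, which also
      determines \<open>W False\<close>.\<close>
    define F where "F = (\<Sum>j=1..(n - 2) div 2. E j)"
    define H where "H = eta ((-1) ^ (n div 2) * (\<Prod>j=1..n. a j)) * real q ^ ((n - 2) div 2)"
    have n: "n div 2 = Suc ((n - 2) div 2)" using n2 t by auto
    have eta: "eta ((-1) ^ (n div 2) * (\<Prod>j=1..n. a j)) = eta (-1 :: 'a) ^ (n div 2) * (\<Prod>j=1..n. eta (a j))"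
      using oq unfolding q_def by (simp only: eta_mult eta_prod eta_power simp_thms)
    have "E (n div 2) = H"
    proof -
      have "{T. T \<subseteq> {1..n} \<and> card T = n} = {{1..n}}"
        using card_subset_eq[of "{1..n}"] by auto
      then have "esym {1..n} (\<lambda>i. eta (a i)) n = (\<Prod>j=1..n. eta (a j))" unfolding esym_def by simp
      moreover have "2 * (n div 2) = n" "n div 2 - 1 = (n - 2) div 2" "t + 1 = 1" using t by auto
      ultimately show ?thesis unfolding E_def H_def eta eta_neg[OF oq] by (simp only:)
    qed
    then have "W True = 1 + real q * (F + H)"
      using W1 oq t n by (simp add: F_def)
    moreover have "W False = real q * H"
    proof -
      have "(\<Prod>j=1..n. if j \<in> {t+1..n} then eta (a j) else 0) = (\<Prod>j=1..n. eta (a j))"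
        by (rule prod.cong) (use t in auto)
      then show ?thesis using t unfolding W0 H_def eta by (simp add: n power_mult_distrib)
    qed
    \<comment> \<open>In the last summand \<open>H\<close> cancels between \<open>W False\<close>
      and \<open>W True\<close>, so it ends up with coefficient \<open>k0\<close>, whereas
      \<open>F\<close> gets \<open>k0 + q - 1\<close>.\<close>
    ultimately have "real q * N = real k0 * ((real q - 1) ^ n - (1 + real q * (F + H)))
        + real q * real q ^ (n - 1) - (real q - 1) ^ n
        + (real q - 1) * (real q * H - (1 + real q * (F + H)))"
      using main q_pow by simp
    then have "N = real q ^ (n - 1) - 1 + (real k0 - 1) * ((real q - 1) ^ n - 1) / real q
        - real k0 * H - (real k0 + real q - 1) * F"
      using q1 by (simp add: field_simps)
    then show "real (Nsol n a b k kk m) =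
        real q ^ (n - 1) - 1 + (real k0 - 1) * ((real q - 1) ^ n - 1) / real q
        - real k0 * eta ((-1) ^ (n div 2) * (\<Prod>j=1..n. a j)) * real q ^ ((n - 2) div 2)
        - (real k0 + real q - 1) *
          (\<Sum>j=1..(n - 2) div 2. eta ((-1) ^ j :: 'a) * esym {1..n} (\<lambda>i. eta (a i)) (2 * j)
                                   * real q ^ (j - 1))"
      using t by (simp add: N_def F_def H_def E_def mult.assoc)
  next
    assume "t = n"
    then show "real (Nsol n a b k kk m) =
        real q ^ (n - 1) - (-1) ^ n + (real k0 - 1) * ((real q - 1) ^ n - (-1) ^ n) / real q"
      using general n2 by (simp add: N_def)
  next
    assume "\<not> (t = 0 \<and> even n) \<and> t \<noteq> n"
    then show "real (Nsol n a b k kk m) =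
        real q ^ (n - 1) - (-1) ^ n + (real k0 - 1) * ((real q - 1) ^ n - (-1) ^ n) / real q
        - (-1) ^ n * (real k0 + real q - 1) *
          (\<Sum>j=1..(n - t) div 2. eta ((-1) ^ j :: 'a) * esym {t+1..n} (\<lambda>i. eta (a i)) (2 * j)
                                   * real q ^ (j - 1))"
      using general unfolding N_def E_def by blast
  qed
qed

end
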